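(* Let $d\ge1$, fix $t>0$, and let $f_n$ ($n\ge1$) and $f$ be measurable functions from $\mathbb{R}_+\times\mathbb{R}^d$ to $\mathbb{R}$ such that the truncated shot noise series $$I_n(t)=\sum_{i\ge1,\;T_i\le t}f_n(T_i,\Delta_i),\qquad I(t)=\sum_{i\ge1,\;T_i\le t}f(T_i,\Delta_i)$$ are well defined. Suppose that, as $n\to+\infty$, $$(\lambda_{[0,t]}\otimes\sigma)f_n^{-1}\stackrel{var}{\longrightarrow}(\lambda_{[0,t]}\otimes\sigma)f^{-1}.$$ Then $\mathcal{L}(I_n(t))\stackrel{var}{\longrightarrow}\mathcal{L}(I(t))$ as $n\to+\infty$.
   Context: $(\Delta_i)_{i\ge1}$ is an i.i.d. sequence of random vectors in $\mathbb{R}^d$ with common law $\sigma$, where $\sigma(\{0\})=0$. Independently, $(T_i)_{i\ge1}$ is the sequence of partial sums of i.i.d. exponential random variables with parameter $\alpha>0$. An empty sum equals $0$. $\lambda_{[0,t]}$ is Lebesgue measure restricted to $[0,t]$, $mf^{-1}$ is the image (pushforward) of a measure $m$ under $f$, and $\mathcal{L}(X)$ is the law of $X$. $\mu_n\stackrel{var}{\longrightarrow}\mu$ means $\|\mu_n-\mu\|\to0$, where $\|\mu\|=\mu_+(\mathbb{R})+\mu_-(\mathbb{R})$ is the total variation norm of a signed measure $\mu$ with Hahn–Jordan decomposition $\mu=\mu_+-\mu_-$. *)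

theory Defs
  imports "HOL-Probability.Probability"
begin

text \<open>
  A finite signed measure on the measurable space of \<open>M\<close> is given by its set function
  \<open>\<nu> :: 'a set \<Rightarrow> real\<close>; the measure structure of \<open>M\<close> itself plays no role.
\<close>

definition hahn_positive_set :: "'a measure \<Rightarrow> ('a set \<Rightarrow> real) \<Rightarrow> 'a set \<Rightarrow> bool" where
  "hahn_positive_set M \<nu> P \<longleftrightarrow> P \<in> sets M
     \<and> (\<forall>A\<in>sets M. A \<subseteq> P \<longrightarrow> 0 \<le> \<nu> A)
     \<and> (\<forall>A\<in>sets M. A \<subseteq> space M - P \<longrightarrow> \<nu> A \<le> 0)"

definition jordan_pos :: "'a measure \<Rightarrow> ('a set \<Rightarrow> real) \<Rightarrow> 'a set \<Rightarrow> real" where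
  "jordan_pos M \<nu> A = \<nu> (A \<inter> (SOME P. hahn_positive_set M \<nu> P))"

definition jordan_neg :: "'a measure \<Rightarrow> ('a set \<Rightarrow> real) \<Rightarrow> 'a set \<Rightarrow> real" where
  "jordan_neg M \<nu> A = - \<nu> (A - (SOME P. hahn_positive_set M \<nu> P))"

definition tv_norm :: "'a measure \<Rightarrow> ('a set \<Rightarrow> real) \<Rightarrow> real" where
  "tv_norm M \<nu> = jordan_pos M \<nu> (space M) + jordan_neg M \<nu> (space M)"

text \<open>Meaningful for finite Borel measures on the line only.\<close>

definition converges_in_variation :: "(nat \<Rightarrow> real measure) \<Rightarrow> real measure \<Rightarrow> bool" where
  "converges_in_variation \<mu> \<mu>' \<longleftrightarrow>
     (\<lambda>n. tv_norm borel (\<lambda>A. measure (\<mu> n) A - measure \<mu>' A)) \<longlonglongrightarrow> 0"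

text \<open>
  The next two facts show that the choice in the Jordan decomposition is harmless: for a
  difference of finite measures a Hahn set exists, and every Hahn set yields the same norm.
\<close>

lemma hahn_positive_set_exists:
  assumes "finite_measure N" "finite_measure N'" "sets N = sets M" "sets N' = sets M"
  shows "\<exists>P. hahn_positive_set M (\<lambda>A. measure N A - measure N' A) P"
proof -
  interpret N: finite_measure N by fact
  interpret N': finite_measure N' by fact
  obtain P where P: "P \<in> sets N"
    and 1: "\<forall>X\<in>sets N. X \<subseteq> P \<longrightarrow> emeasure N' X \<le> emeasure N X"
    and 2: "\<forall>X\<in>sets N. X \<inter> P = {} \<longrightarrow> emeasure N X \<le> emeasure N' X"
    using finite_unsigned_Hahn_decomposition[of N N'] assms by auto
  have "measure N' A \<le> measure N A" if "A \<in> sets M" "A \<subseteq> P" for A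
    using 1 that assms by (simp add: N.emeasure_eq_measure N'.emeasure_eq_measure)
  moreover have "measure N A \<le> measure N' A" if "A \<in> sets M" "A \<subseteq> space M - P" for A
  proof -
    have "A \<inter> P = {}" using that by auto
    then show ?thesis
      using 2 that assms by (simp add: N.emeasure_eq_measure N'.emeasure_eq_measure)
  qed
  ultimately show ?thesis
    using P assms unfolding hahn_positive_set_def by (intro exI[of _ P]) auto
qed

lemma tv_norm_eq:
  assumes N: "finite_measure N" "finite_measure N'" "sets N = sets M" "sets N' = sets M"
    and P: "hahn_positive_set M (\<lambda>A. measure N A - measure N' A) P"
  shows "tv_norm M (\<lambda>A. measure N A - measure N' A) =
    (measure N P - measure N' P) - (measure N (space M - P) - measure N' (space M - P))"
proof -
  interpret N: finite_measure N by fact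
  interpret N': finite_measure N' by fact
  let ?\<nu> = "\<lambda>A. measure N A - measure N' A"
  define Q where "Q = (SOME P. hahn_positive_set M ?\<nu> P)"
  have Q: "hahn_positive_set M ?\<nu> Q"
    unfolding Q_def using hahn_positive_set_exists[OF N] by (rule someI_ex)
  have PQ[simp]: "P \<in> sets M" "Q \<in> sets M"
    using P Q by (auto simp: hahn_positive_set_def)
  have sub: "P \<subseteq> space M" "Q \<subseteq> space M"
    using PQ by (simp_all only: sets.sets_into_space)
  have split: "?\<nu> A = ?\<nu> (A \<inter> B) + ?\<nu> (A - B)" if "A \<in> sets M" "B \<in> sets M" for A B
    using that N N.finite_measure_Union[of "A \<inter> B" "A - B"]
      N'.finite_measure_Union[of "A \<inter> B" "A - B"]
    by (simp add: Int_Diff_Un Int_Diff_disjoint)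
  have "?\<nu> (P - Q) = 0"
  proof (rule antisym)
    have "P - Q \<in> sets M" "P - Q \<subseteq> P" "P - Q \<subseteq> space M - Q" using sub by auto
    then show "?\<nu> (P - Q) \<le> 0" "0 \<le> ?\<nu> (P - Q)"
      using P Q unfolding hahn_positive_set_def by blast+
  qed
  moreover have "?\<nu> (Q - P) = 0"
  proof (rule antisym)
    have "Q - P \<in> sets M" "Q - P \<subseteq> Q" "Q - P \<subseteq> space M - P" using sub by auto
    then show "?\<nu> (Q - P) \<le> 0" "0 \<le> ?\<nu> (Q - P)"
      using P Q unfolding hahn_positive_set_def by blast+
  qed
  ultimately have eq: "?\<nu> P = ?\<nu> Q"
    using split[of P Q] split[of Q P] by (simp add: Int_commute)
  have tot: "?\<nu> (space M) = ?\<nu> P + ?\<nu> (space M - P)"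
    "?\<nu> (space M) = ?\<nu> Q + ?\<nu> (space M - Q)"
    using split[of "space M" P] split[of "space M" Q] sub by (simp_all add: Int_absorb1)
  have "tv_norm M ?\<nu> = ?\<nu> Q - ?\<nu> (space M - Q)"
    unfolding tv_norm_def jordan_pos_def jordan_neg_def Q_def[symmetric]
    using sub by (simp add: Int_absorb1)
  then show ?thesis using eq tot by linarith
qed

text \<open>
  Independence of two random elements whose value spaces have different types, which
  \<open>prob_space.indep_var\<close> does not cover.
\<close>

definition indep_elements ::
    "'w measure \<Rightarrow> 'a measure \<Rightarrow> ('w \<Rightarrow> 'a) \<Rightarrow> 'b measure \<Rightarrow> ('w \<Rightarrow> 'b) \<Rightarrow> bool" where
  "indep_elements M S X S' Y \<longleftrightarrow>
     X \<in> measurable M S \<and> Y \<in> measurable M S' \<and>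
     prob_space.indep_set M {X -` A \<inter> space M | A. A \<in> sets S}
                            {Y -` B \<inter> space M | B. B \<in> sets S'}"

definition arrival_time :: "(nat \<Rightarrow> 'w \<Rightarrow> real) \<Rightarrow> nat \<Rightarrow> 'w \<Rightarrow> real" where
  "arrival_time \<xi> i \<omega> = (\<Sum>j=1..i. \<xi> j \<omega>)"

text \<open>
  The integrand \<open>f\<close> is defined on nonnegative times only, so the condition \<open>T i \<omega> \<le> t\<close> is
  written \<open>T i \<omega> \<in> {0..t}\<close>; the two agree almost surely for sums of exponential variables,
  and the values of \<open>f\<close> at negative times, which are junk, are never used.
\<close>

definition shot_noise_term ::
    "(nat \<Rightarrow> 'w \<Rightarrow> real) \<Rightarrow> (nat \<Rightarrow> 'w \<Rightarrow> 'v) \<Rightarrow> (real \<times> 'v \<Rightarrow> real) \<Rightarrow> real \<Rightarrow> 'w \<Rightarrow> nat \<Rightarrow> real" where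
  "shot_noise_term T \<Delta> f t \<omega> i =
     (if 1 \<le> i \<and> T i \<omega> \<in> {0..t} then f (T i \<omega>, \<Delta> i \<omega>) else 0)"

definition shot_noise_well_defined ::
    "'w measure \<Rightarrow> (nat \<Rightarrow> 'w \<Rightarrow> real) \<Rightarrow> (nat \<Rightarrow> 'w \<Rightarrow> 'v) \<Rightarrow> (real \<times> 'v \<Rightarrow> real) \<Rightarrow> real \<Rightarrow> bool" where
  "shot_noise_well_defined M T \<Delta> f t \<longleftrightarrow> (AE \<omega> in M. summable (shot_noise_term T \<Delta> f t \<omega>))"

definition shot_noise ::
    "(nat \<Rightarrow> 'w \<Rightarrow> real) \<Rightarrow> (nat \<Rightarrow> 'w \<Rightarrow> 'v) \<Rightarrow> (real \<times> 'v \<Rightarrow> real) \<Rightarrow> real \<Rightarrow> 'w \<Rightarrow> real" where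
  "shot_noise T \<Delta> f t \<omega> = (\<Sum>i. shot_noise_term T \<Delta> f t \<omega> i)"

end

theory Submission
  imports Defs
begin

text \<open>
  The law of \<open>I(t)\<close> depends on \<open>f\<close> only through \<open>\<rho> = (\<lambda>\<^bsub>[0,t]\<^esub> \<otimes> \<sigma>) f\<^sup>-\<^sup>1\<close>: it is compound
  Poisson with rate \<open>\<alpha> t\<close> and jump law \<open>\<nu> = \<rho> / t\<close>. To see this without order statistics of
  uniform variables, put \<open>c(u) = E exp(i \<theta> f(u, \<Delta>))\<close> on \<open>[0,t]\<close> and \<open>c = 1\<close> elsewhere; then
  \<open>\<phi>(s) = exp(\<alpha> \<integral>\<^bsub>[s,t]\<^esub> (c - 1))\<close> satisfies \<open>E (c(s + \<xi>) \<phi>(s + \<xi>)) = \<phi>(s)\<close>, so that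
  \<open>c(T\<^sub>1) \<cdots> c(T\<^sub>m) \<phi>(T\<^sub>m)\<close> has mean \<open>\<phi>(0)\<close> for every \<open>m\<close>, and \<open>m \<rightarrow> \<infinity>\<close> gives the
  characteristic function of \<open>I(t)\<close>. Finally the \<open>k\<close>-fold convolution powers of two laws
  that differ by at most \<open>\<epsilon>\<close> on every set differ by at most \<open>min 1 (k \<epsilon>)\<close>, whose Poisson
  mean tends to \<open>0\<close> with \<open>\<epsilon>\<close>.
\<close>

section \<open>The exponential of an indefinite integral\<close>

text \<open>A bridge between the two integrals in use: boundedness on an interval of finite length
  gives Lebesgue integrability, hence gauge integrability with the same value. Intervals are split
  with the gauge integral; measurability and expectations go through \<open>lborel\<close>.\<close>

lemma integral_lborel_indicator_bounded:
  fixes c :: "real \<Rightarrow> complex"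
  assumes [measurable]: "c \<in> borel_measurable borel" and B: "\<And>u. norm (c u) \<le> B"
  shows "c integrable_on {x..y}"
    and "integral {x..y} c = (\<integral>u. indicator {x..y} u *\<^sub>R c u \<partial>lborel)"
proof -
  have "set_integrable lborel {x..y} c"
    unfolding set_integrable_def
    by (rule integrableI_bounded_set_indicator[where B=B]) (auto simp: B emeasure_lborel_Icc_eq)
  from set_borel_integral_eq_integral[OF this]
  show "c integrable_on {x..y}" "integral {x..y} c = (\<integral>u. indicator {x..y} u *\<^sub>R c u \<partial>lborel)"
    by (auto simp: set_lebesgue_integral_def)
qed

lemma norm_integral_le_length:
  fixes c :: "real \<Rightarrow> complex"
  assumes "c integrable_on {x..y}" "x \<le> y" "\<And>u. u \<in> {x..y} \<Longrightarrow> norm (c u) \<le> K"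
  shows "norm (integral {x..y} c) \<le> K * (y - x)"
proof -
  have "0 \<le> K"
    using assms(2) order_trans[OF norm_ge_zero assms(3)[of x]] by auto
  then show ?thesis
    using has_integral_bound_real[OF _ finite.emptyI, of K c "integral {x..y} c" x y] assms
    by (auto simp: integrable_integral)
qed

lemma norm_exp_minus_one_minus_le:
  fixes z :: complex
  shows "norm (exp z - 1 - z) \<le> exp (norm z) * (norm z)\<^sup>2"
proof -
  have "norm (exp z - 1 - z) \<le> exp \<bar>Re z\<bar> * (norm z)\<^sup>2"
    using Taylor_exp[of z 1] by (simp add: algebra_simps numeral_2_eq_2)
  also have "\<dots> \<le> exp (norm z) * (norm z)\<^sup>2"
    by (intro mult_right_mono) (auto simp: abs_Re_le_cmod)
  finally show ?thesis .
qed

text \<open>The bound makes the derivative of \<open>H\<close> vanish at every point of the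
  interval, and a function with zero derivative on an interval is constant.\<close>

lemma constant_of_quadratic_increments:
  fixes H :: "real \<Rightarrow> complex"
  assumes "a \<le> b"
    and H: "\<And>x y. a \<le> x \<Longrightarrow> x \<le> y \<Longrightarrow> y \<le> b \<Longrightarrow> norm (H x - H y) \<le> K * (y - x)\<^sup>2"
  shows "H a = H b"
proof -
  have *: "norm (H y - H x) \<le> K * \<bar>y - x\<bar> * \<bar>y - x\<bar>" if "x \<in> {a..b}" "y \<in> {a..b}" for x y
    using H[of x y] H[of y x] that
    by (cases "x \<le> y") (auto simp: power2_eq_square norm_minus_commute abs_if algebra_simps)
  have "(H has_derivative (\<lambda>h. 0)) (at x within {a..b})" if x: "x \<in> {a..b}" for x
    unfolding has_derivative_within_alt
  proof (intro conjI allI impI)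
    show "bounded_linear (\<lambda>h::real. 0::complex)" by simp
    fix e :: real assume e: "e > 0"
    \<comment> \<open>The sign of \<open>K\<close> is unknown and \<open>K\<close> may be 0, so the
      radius is obtained by dividing by \<open>\<bar>K\<bar> + 1\<close>.\<close>
    show "\<exists>d>0. \<forall>y\<in>{a..b}. norm (y - x) < d \<longrightarrow> norm (H y - H x - 0) \<le> e * norm (y - x)"
    proof (intro exI[of _ "e / (\<bar>K\<bar> + 1)"] conjI ballI impI)
      show "e / (\<bar>K\<bar> + 1) > 0" using e by auto
      fix y assume y: "y \<in> {a..b}" "norm (y - x) < e / (\<bar>K\<bar> + 1)"
      have "K * \<bar>y - x\<bar> \<le> (\<bar>K\<bar> + 1) * \<bar>y - x\<bar>"
        by (intro mult_right_mono) auto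
      also have "\<dots> \<le> e"
        using y(2) by (simp add: field_simps)
      finally have "K * \<bar>y - x\<bar> * \<bar>y - x\<bar> \<le> e * \<bar>y - x\<bar>"
        by (intro mult_right_mono) auto
      then show "norm (H y - H x - 0) \<le> e * norm (y - x)"
        using *[OF x y(1)] by simp
    qed
  qed
  then have "\<exists>k. \<forall>x\<in>{a..b}. H x = k"
    by (intro has_derivative_zero_constant) auto
  then show ?thesis using \<open>a \<le> b\<close> by auto
qed

text \<open>As a Lebesgue integral, the lower limit \<open>s\<close> enters only through the
  condition \<open>s \<le> u \<le> t\<close>, which is jointly measurable in \<open>s\<close> and
  \<open>u\<close>; integrating out \<open>u\<close> preserves measurability in
  \<open>s\<close>.\<close>

lemma borel_measurable_integral_lower:
  fixes c :: "real \<Rightarrow> complex"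
  assumes [measurable]: "c \<in> borel_measurable borel" and B: "\<And>u. norm (c u) \<le> B"
  shows "(\<lambda>s. integral {s..t} c) \<in> borel_measurable borel"
proof -
  have "(\<lambda>s. \<integral>u. indicator {s..t} u *\<^sub>R c u \<partial>lborel) \<in> borel_measurable borel"
    unfolding indicator_def atLeastAtMost_iff by measurable
  then show ?thesis
    by (simp add: integral_lborel_indicator_bounded(2)[OF assms])
qed

text \<open>
  As \<open>c\<close> is merely measurable, the indefinite integral need not be differentiable
  everywhere; but the difference of the two sides, as a function of \<open>a\<close>, has increments of
  quadratic order and is therefore constant.
\<close>

lemma has_integral_times_exp_integral:
  fixes c :: "real \<Rightarrow> complex"
  assumes meas[measurable]: "c \<in> borel_measurable borel" and B: "\<And>u. norm (c u) \<le> B"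
    and "a \<le> t"
  shows "((\<lambda>u. c u * exp (integral {u..t} c)) has_integral (exp (integral {a..t} c) - 1)) {a..t}"
proof -
  define C where "C u = integral {u..t} c" for u
  define L where "L = t - a"
  have L: "L \<ge> 0" using \<open>a \<le> t\<close> by (simp add: L_def)
  have B0: "B \<ge> 0" using norm_ge_zero[of "c 0"] B[of 0] by linarith
  have [measurable]: "C \<in> borel_measurable borel"
    unfolding C_def by (rule borel_measurable_integral_lower[OF meas B])
  have int: "c integrable_on {x..y}" for x y
    by (rule integral_lborel_indicator_bounded(1)[OF meas B])
  have incr: "C x - C y = integral {x..y} c" if "a \<le> x" "x \<le> y" "y \<le> t" for x y
    unfolding C_def using that int
    by (simp add: Henstock_Kurzweil_Integration.integral_combine[symmetric, of x y t])
  have incr_le: "norm (integral {x..y} c) \<le> B * (y - x)" if "x \<le> y" for x y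
    using that int B by (intro norm_integral_le_length) auto
  \<comment> \<open>On \<open>[a,t]\<close> the norm of \<open>C\<close> is at most
    \<open>B * L\<close>, so \<open>M\<close> bounds \<open>exp (C x)\<close> there, and also
    \<open>exp (norm z)\<close> for every increment \<open>z\<close> of \<open>C\<close>.\<close>
  define M where "M = exp (B * L)"
  have M: "M > 0" by (simp add: M_def)
  have C_le: "norm (exp (C x)) \<le> M" if "a \<le> x" "x \<le> t" for x
  proof -
    have "norm (C x) \<le> B * (t - x)" using that incr_le unfolding C_def by auto
    also have "\<dots> \<le> B * L" using that B0 by (intro mult_left_mono) (auto simp: L_def)
    finally show ?thesis
      unfolding M_def using norm_exp[of "C x"] by (smt (verit) exp_le_cancel_iff)
  qed
  define g where "g u = c u * exp (C u)" for u
  \<comment> \<open>To the left of \<open>a\<close> the factor \<open>exp (C u)\<close> may be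
    unbounded; the cut-off is bounded everywhere, as the integrability lemma demands.\<close>
  define g' where "g' u = (if u \<in> {a..t} then g u else 0)" for u
  have [measurable]: "g' \<in> borel_measurable borel"
    unfolding g'_def g_def by measurable
  have g'_le: "norm (g' u) \<le> B * M" for u
    using B B0 M C_le by (auto simp: g'_def g_def norm_mult intro!: mult_mono)
  have g_int: "g integrable_on {x..y}" if "a \<le> x" "y \<le> t" for x y
  proof -
    have "g' integrable_on {x..y}"
      by (rule integral_lborel_indicator_bounded(1)[OF _ g'_le]) simp
    then show ?thesis
      by (rule integrable_eq) (use that in \<open>auto simp: g'_def\<close>)
  qed
  \<comment> \<open>The claim is \<open>H a = H t\<close>: at \<open>t\<close> both integrals run
    over a single point, so \<open>H t = 1\<close>.\<close>
  define H where "H x = exp (C x) - integral {x..t} g" for x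
  have exp_diff: "norm (exp (C x) - exp (C y) - exp (C y) * (C x - C y)) \<le> M * M * B\<^sup>2 * (y - x)\<^sup>2"
    if xy: "a \<le> x" "x \<le> y" "y \<le> t" for x y
  proof -
    define z where "z = C x - C y"
    have z: "norm z \<le> B * (y - x)" using incr[OF xy] incr_le[of x y] xy by (simp add: z_def)
    have "B * (y - x) \<le> B * L" using xy B0 by (intro mult_left_mono) (auto simp: L_def)
    then have ez: "exp (norm z) \<le> M" using z by (simp add: M_def)
    have "exp (C x) = exp (C y) * exp z" by (simp add: z_def mult_exp_exp)
    then have "exp (C x) - exp (C y) - exp (C y) * (C x - C y) = exp (C y) * (exp z - 1 - z)"
      by (simp add: z_def[symmetric] algebra_simps)
    then have "norm (exp (C x) - exp (C y) - exp (C y) * (C x - C y))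
        = norm (exp (C y)) * norm (exp z - 1 - z)"
      by (simp only: norm_mult)
    also have "\<dots> \<le> M * (M * (B * (y - x))\<^sup>2)"
    proof (rule mult_mono)
      have "norm (exp z - 1 - z) \<le> exp (norm z) * (norm z)\<^sup>2" by (rule norm_exp_minus_one_minus_le)
      also have "\<dots> \<le> M * (B * (y - x))\<^sup>2"
        using ez z M by (intro mult_mono power_mono) auto
      finally show "norm (exp z - 1 - z) \<le> M * (B * (y - x))\<^sup>2" .
    qed (use C_le xy M in auto)
    finally show ?thesis by (simp add: power_mult_distrib mult_ac)
  qed
  have exp_lip: "norm (exp (C x) - exp (C y)) \<le> (M * M * B\<^sup>2 * L + M * B) * (y - x)"
    if xy: "a \<le> x" "x \<le> y" "y \<le> t" for x y
  proof -
    have "norm (exp (C x) - exp (C y)) \<le>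
        norm (exp (C x) - exp (C y) - exp (C y) * (C x - C y)) + norm (exp (C y) * (C x - C y))"
      by (metis add.commute norm_triangle_sub)
    also have "\<dots> \<le> M * M * B\<^sup>2 * (y - x)\<^sup>2 + M * (B * (y - x))"
      using exp_diff[OF xy] C_le[of y] incr_le[of x y] incr[OF xy] xy M
      by (intro add_mono) (auto simp: norm_mult intro!: mult_mono)
    also have "M * M * B\<^sup>2 * (y - x)\<^sup>2 \<le> M * M * B\<^sup>2 * (L * (y - x))"
      using xy M unfolding power2_eq_square[of "y - x"]
      by (intro mult_left_mono mult_right_mono) (auto simp: L_def)
    finally show ?thesis
      by (simp add: algebra_simps)
  qed
  \<comment> \<open>The first summand pays for the second-order remainder of the exponential, the
    second for replacing \<open>exp (C u)\<close> by \<open>exp (C y)\<close> inside the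
    integral.\<close>
  define K where "K = M * M * B\<^sup>2 + B * (M * M * B\<^sup>2 * L + M * B)"
  have "norm (H x - H y) \<le> K * (y - x)\<^sup>2" if xy: "a \<le> x" "x \<le> y" "y \<le> t" for x y
  proof -
    have "integral {x..t} g = integral {x..y} g + integral {y..t} g"
      using xy g_int by (simp add: Henstock_Kurzweil_Integration.integral_combine)
    \<comment> \<open>Freezing the exponential at the right end produces exactly
      \<open>exp (C y) * (C x - C y)\<close>, which cancels the first-order part of
      \<open>exp (C x) - exp (C y)\<close>.\<close>
    moreover have "integral {x..y} g = integral {x..y} (\<lambda>u. c u * (exp (C u) - exp (C y)))
        + exp (C y) * (C x - C y)"
    proof -
      have "integral {x..y} (\<lambda>u. g u - c u * exp (C y)) = integral {x..y} g - integral {x..y} c * exp (C y)"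
        using xy int g_int by (subst Henstock_Kurzweil_Integration.integral_diff)
          (auto intro!: integrable_on_mult_left)
      then show ?thesis by (simp add: incr[OF xy] g_def algebra_simps)
    qed
    ultimately have eq: "H x - H y = (exp (C x) - exp (C y) - exp (C y) * (C x - C y))
        - integral {x..y} (\<lambda>u. c u * (exp (C u) - exp (C y)))"
      by (simp add: H_def)
    have "norm (integral {x..y} (\<lambda>u. c u * (exp (C u) - exp (C y))))
        \<le> (B * ((M * M * B\<^sup>2 * L + M * B) * (y - x))) * (y - x)"
    proof (rule norm_integral_le_length)
      have "(\<lambda>u. g u - c u * exp (C y)) integrable_on {x..y}"
        using xy int g_int by (intro integrable_diff integrable_on_mult_left) auto
      then show "(\<lambda>u. c u * (exp (C u) - exp (C y))) integrable_on {x..y}"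
        by (simp add: g_def algebra_simps)
      fix u assume u: "u \<in> {x..y}"
      have "norm (exp (C u) - exp (C y)) \<le> (M * M * B\<^sup>2 * L + M * B) * (y - u)"
        using u xy by (intro exp_lip) auto
      also have "\<dots> \<le> (M * M * B\<^sup>2 * L + M * B) * (y - x)"
        using u L M B0 by (intro mult_left_mono) auto
      finally show "norm (c u * (exp (C u) - exp (C y))) \<le> B * ((M * M * B\<^sup>2 * L + M * B) * (y - x))"
        unfolding norm_mult using B B0 by (intro mult_mono) auto
    qed (use xy in auto)
    with exp_diff[OF xy] show ?thesis
      unfolding eq K_def
      by (intro order_trans[OF norm_triangle_ineq4]) (simp add: algebra_simps power2_eq_square)
  qed
  then have "H a = H t"
    using constant_of_quadratic_increments[of a t H K] \<open>a \<le> t\<close> by blast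
  then have "integral {a..t} g = exp (C a) - 1"
    by (simp add: H_def C_def algebra_simps)
  then show ?thesis
    using g_int[of a t] by (simp add: has_integral_integral C_def g_def[abs_def])
qed

section \<open>A fixed point of the exponential kernel\<close>

text \<open>\<open>c u\<close> is the mean weight of an arrival at time \<open>u\<close>; weight 1
  leaves a product unchanged. The bound \<open>B\<close> is kept free because two weights occur:
  characteristic functions of the marks (\<open>B = 1\<close>) and the counting weight
  (\<open>B = 2\<close>).\<close>

locale unit_outside_horizon =
  fixes c :: "real \<Rightarrow> complex" and B t \<alpha> :: real
  assumes measurable_c[measurable]: "c \<in> borel_measurable borel"
    and norm_c_le: "norm (c u) \<le> B"
    and c_outside: "u \<notin> {0..t} \<Longrightarrow> c u = 1"
    and t_nonneg: "0 \<le> t"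
    and \<alpha>_pos: "0 < \<alpha>"
begin

text \<open>This is the probability generating functional of a Poisson process of rate \<alpha> on
  \<open>[s,t]\<close>: the mean of the product of \<open>c\<close> over its points.\<close>

definition \<phi> :: "real \<Rightarrow> complex" where
  "\<phi> s = exp (of_real \<alpha> * integral {s..t} (\<lambda>u. c u - 1))"

lemma norm_c_minus_one_le: "norm (c u - 1) \<le> B + 1"
  using norm_triangle_ineq4[of "c u" 1] norm_c_le[of u] by simp

lemma B_nonneg: "0 \<le> B"
  using norm_c_le[of 0] norm_ge_zero[of "c 0"] by linarith

lemma measurable_\<phi>[measurable]: "\<phi> \<in> borel_measurable borel"
proof -
  have [measurable]: "(\<lambda>s. integral {s..t} (\<lambda>u. c u - 1)) \<in> borel_measurable borel"
    by (rule borel_measurable_integral_lower[OF _ norm_c_minus_one_le]) measurable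
  show ?thesis unfolding \<phi>_def[abs_def] by measurable
qed

lemma \<phi>_beyond: "t < s \<Longrightarrow> \<phi> s = 1"
  by (simp add: \<phi>_def)

text \<open>The integrand \<open>c u - 1\<close> vanishes off \<open>[0,t]\<close>, so only the
  length \<open>t\<close> counts and the bound is uniform in \<open>s\<close>, negative
  \<open>s\<close> included.\<close>

lemma norm_\<phi>_le: "norm (\<phi> s) \<le> exp (\<alpha> * ((B + 1) * t))"
proof -
  have "norm (integral {s..t} (\<lambda>u. c u - 1)) = norm (\<integral>u. indicator {s..t} u *\<^sub>R (c u - 1) \<partial>lborel)"
    by (subst integral_lborel_indicator_bounded(2)[OF _ norm_c_minus_one_le]) auto
  also have "\<dots> \<le> (\<integral>u. (B + 1) * indicator {0..t} u \<partial>lborel)"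
  proof (rule Bochner_Integration.integral_norm_bound_integral)
    show "integrable lborel (\<lambda>u. indicator {s..t} u *\<^sub>R (c u - 1))"
      by (rule integrableI_bounded_set_indicator[where B="B + 1"])
        (auto simp: norm_c_minus_one_le emeasure_lborel_Icc_eq)
    show "norm (indicator {s..t} u *\<^sub>R (c u - 1)) \<le> (B + 1) * indicator {0..t} u" for u
      using norm_c_minus_one_le[of u] c_outside[of u] B_nonneg by (auto simp: indicator_def)
  qed (auto simp: emeasure_lborel_Icc_eq)
  also have "\<dots> = (B + 1) * t"
    using t_nonneg by simp
  finally have "norm (of_real \<alpha> * integral {s..t} (\<lambda>u. c u - 1)) \<le> \<alpha> * ((B + 1) * t)"
    using \<alpha>_pos by (simp add: norm_mult)
  then show ?thesis
    unfolding \<phi>_def by (intro order_trans[OF norm_exp]) simp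
qed

text \<open>This is the equation obtained by conditioning on the first arrival after
  \<open>s\<close>: its weight is \<open>c\<close>, and the later arrivals contribute \<phi> at that
  time.\<close>

lemma \<phi>_fixpoint:
  "(\<integral>r. exponential_density \<alpha> r *\<^sub>R (c (s + r) * \<phi> (s + r)) \<partial>lborel) = \<phi> s"
proof -
  interpret E: prob_space "density lborel (exponential_density \<alpha>)"
    by (rule prob_space_exponential_density[OF \<alpha>_pos])
  define K where "K = B * exp (\<alpha> * ((B + 1) * t))"
  have G_le: "norm (c u * \<phi> u) \<le> K" for u
    unfolding K_def norm_mult using norm_c_le norm_\<phi>_le B_nonneg by (intro mult_mono) auto
  have dens_nonneg: "0 \<le> exponential_density \<alpha> r" for r
    using \<alpha>_pos by (simp add: exponential_density_def)
  have dens_le: "exponential_density \<alpha> r \<le> \<alpha>" for r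
    using \<alpha>_pos by (auto simp: exponential_density_def)
  \<comment> \<open>Subtracting 1, the total mass of the density, allows the integral to be cut at
    the horizon.\<close>
  have "(\<integral>r. exponential_density \<alpha> r *\<^sub>R (c (s + r) * \<phi> (s + r)) \<partial>lborel) - 1
    = (\<integral>r. c (s + r) * \<phi> (s + r) \<partial>density lborel (exponential_density \<alpha>)) - 1"
    using dens_nonneg by (subst integral_density) auto
  also have "\<dots> = (\<integral>r. c (s + r) * \<phi> (s + r) - 1 \<partial>density lborel (exponential_density \<alpha>))"
    by (subst Bochner_Integration.integral_diff)
      (auto intro!: E.integrable_const_bound[where B=K] simp: G_le E.prob_space[simplified])
  also have "\<dots> = (\<integral>r. exponential_density \<alpha> r *\<^sub>R (c (s + r) * \<phi> (s + r) - 1) \<partial>lborel)"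
    using dens_nonneg by (subst integral_density) auto
  also have "\<dots> = (\<integral>u. exponential_density \<alpha> (u - s) *\<^sub>R (c u * \<phi> u - 1) \<partial>lborel)"
    by (subst lborel_integral_real_affine[of 1 _ s]) (auto simp: algebra_simps)
  \<comment> \<open>The two sides of the interval drop out for different reasons: the density
    vanishes to the left of \<open>s\<close>, and \<open>c u * \<phi> u = 1\<close> to the right of
    \<open>t\<close>.\<close>
  also have "\<dots> = (\<integral>u. indicator {s..t} u *\<^sub>R (exponential_density \<alpha> (u - s) *\<^sub>R (c u * \<phi> u - 1)) \<partial>lborel)"
  proof (intro Bochner_Integration.integral_cong refl)
    fix u
    have "c u * \<phi> u = 1" if "t < u"
      using that by (simp add: c_outside \<phi>_beyond)
    then show "exponential_density \<alpha> (u - s) *\<^sub>R (c u * \<phi> u - 1) =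
        indicator {s..t} u *\<^sub>R (exponential_density \<alpha> (u - s) *\<^sub>R (c u * \<phi> u - 1))"
      by (cases "t < u") (auto simp: indicator_def exponential_density_def)
  qed
  also have "\<dots> = integral {s..t} (\<lambda>u. exponential_density \<alpha> (u - s) *\<^sub>R (c u * \<phi> u - 1))"
  proof (rule integral_lborel_indicator_bounded(2)[symmetric])
    fix u
    have "norm (c u * \<phi> u - 1) \<le> K + 1"
      using norm_triangle_ineq4[of "c u * \<phi> u" 1] G_le[of u] by simp
    then show "norm (exponential_density \<alpha> (u - s) *\<^sub>R (c u * \<phi> u - 1)) \<le> \<alpha> * (K + 1)"
      using dens_nonneg[of "u - s"] dens_le[of "u - s"] \<alpha>_pos by (auto intro!: mult_mono)
  qed measurable
  also have "\<dots> = \<phi> s - 1"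
  proof (cases "s \<le> t")
    case False
    then show ?thesis by (simp add: \<phi>_beyond)
  next
    case True
    \<comment> \<open>Once the factor \<open>exp (\<alpha> * (s - t))\<close> is pulled out,
      \<open>g c1\<close> is the part of the integrand containing \<open>c u * \<phi> u\<close> and
      \<open>g c2\<close> the part containing 1; the exponential identity integrates both.\<close>
    define c1 where "c1 u = of_real \<alpha> * c u" for u
    define c2 where "c2 u = complex_of_real \<alpha>" for u :: real
    define g where "g c u = c u * exp (integral {u..t} c)" for c :: "real \<Rightarrow> complex" and u
    have c1: "c1 \<in> borel_measurable borel" "norm (c1 u) \<le> \<alpha> * B" for u
      using \<alpha>_pos norm_c_le by (auto simp: c1_def[abs_def] norm_mult)
    have c2: "c2 \<in> borel_measurable borel" "norm (c2 u) \<le> \<alpha>" for u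
      using \<alpha>_pos by (auto simp: c2_def[abs_def])
    have c2_integral: "integral {u..t} c2 = of_real (\<alpha> * (t - u))" if "u \<le> t" for u
      using that by (simp add: c2_def[abs_def] scaleR_conv_of_real mult.commute)
    have \<phi>_eq: "\<phi> u = exp (integral {u..t} c1) * exp (of_real (\<alpha> * (u - t)))" if "u \<le> t" for u
    proof -
      have "integral {u..t} (\<lambda>u. c u - 1) = integral {u..t} c - of_real (t - u)"
        using that integral_lborel_indicator_bounded(1)[OF measurable_c norm_c_le]
        by (subst Henstock_Kurzweil_Integration.integral_diff) (auto simp: scaleR_conv_of_real)
      moreover have "integral {u..t} c1 = of_real \<alpha> * integral {u..t} c"
        by (simp add: c1_def[abs_def])
      ultimately have "of_real \<alpha> * integral {u..t} (\<lambda>u. c u - 1) = integral {u..t} c1 + of_real (\<alpha> * (u - t))"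
        by (simp only:) (simp add: algebra_simps)
      then show ?thesis by (simp add: \<phi>_def exp_add)
    qed
    have int: "((\<lambda>u. g c1 u - g c2 u) has_integral
        (exp (integral {s..t} c1) - 1 - (exp (integral {s..t} c2) - 1))) {s..t}"
      unfolding g_def
      by (intro has_integral_diff has_integral_times_exp_integral[OF c1 True]
          has_integral_times_exp_integral[OF c2 True])
    have "integral {s..t} (\<lambda>u. exponential_density \<alpha> (u - s) *\<^sub>R (c u * \<phi> u - 1))
      = integral {s..t} (\<lambda>u. of_real (exp (\<alpha> * (s - t))) * (g c1 u - g c2 u))"
    proof (rule integral_cong)
      fix u assume u: "u \<in> {s..t}"
      have 1: "complex_of_real (exponential_density \<alpha> (u - s)) = of_real \<alpha> * exp (of_real (\<alpha> * (s - u)))"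
      proof -
        have "exponential_density \<alpha> (u - s) = \<alpha> * exp (\<alpha> * (s - u))"
          using u by (simp add: exponential_density_def algebra_simps)
        then show ?thesis by (simp only: exp_of_real of_real_mult[of \<alpha> "exp _"])
      qed
      have 2: "complex_of_real (exp (\<alpha> * (s - t))) = exp (of_real (\<alpha> * (s - u))) * exp (of_real (\<alpha> * (u - t)))"
        by (simp add: exp_of_real[symmetric] exp_add[symmetric] algebra_simps)
      have 3: "exp (of_real (\<alpha> * (u - t))) * g c2 u = complex_of_real \<alpha>"
        using u by (simp add: g_def c2_integral) (simp add: c2_def exp_add[symmetric] exp_minus_inverse algebra_simps)
      have "exponential_density \<alpha> (u - s) *\<^sub>R (c u * \<phi> u - 1)
        = exp (of_real (\<alpha> * (s - u))) * (c1 u * \<phi> u - of_real \<alpha>)"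
        unfolding scaleR_conv_of_real 1 by (simp add: c1_def algebra_simps)
      also have "c1 u * \<phi> u = exp (of_real (\<alpha> * (u - t))) * g c1 u"
        using u by (simp add: \<phi>_eq g_def)
      finally show "exponential_density \<alpha> (u - s) *\<^sub>R (c u * \<phi> u - 1)
          = of_real (exp (\<alpha> * (s - t))) * (g c1 u - g c2 u)"
        unfolding 2 3[symmetric] by (simp add: algebra_simps)
    qed
    also have "\<dots> = of_real (exp (\<alpha> * (s - t))) *
        (exp (integral {s..t} c1) - 1 - (exp (integral {s..t} c2) - 1))"
      by (rule integral_unique[OF has_integral_mult_right[OF int]])
    also have "\<dots> = \<phi> s - 1"
      using True by (simp add: \<phi>_eq c2_integral exp_of_real[symmetric] exp_add[symmetric] algebra_simps)
    finally show ?thesis .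
  qed
  finally show ?thesis by simp
qed

end

section \<open>Products of weights along the arrival times\<close>

lemma (in prob_space) distr_Pair_eq_pair_measure:
  assumes X[measurable]: "X \<in> measurable M S" and Y[measurable]: "Y \<in> measurable M S'"
    and prod: "\<And>A B. A \<in> sets S \<Longrightarrow> B \<in> sets S' \<Longrightarrow>
      prob (X -` A \<inter> space M \<inter> (Y -` B \<inter> space M)) = prob (X -` A \<inter> space M) * prob (Y -` B \<inter> space M)"
  shows "distr M S X \<Otimes>\<^sub>M distr M S' Y = distr M (S \<Otimes>\<^sub>M S') (\<lambda>\<omega>. (X \<omega>, Y \<omega>))"
proof (rule pair_measure_eqI)
  interpret X: prob_space "distr M S X" by (rule prob_space_distr) simp
  interpret Y: prob_space "distr M S' Y" by (rule prob_space_distr) simp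
  show "sigma_finite_measure (distr M S X)" "sigma_finite_measure (distr M S' Y)" ..
  fix A B assume "A \<in> sets (distr M S X)" "B \<in> sets (distr M S' Y)"
  then have [measurable]: "A \<in> sets S" "B \<in> sets S'" by auto
  have "(\<lambda>\<omega>. (X \<omega>, Y \<omega>)) -` (A \<times> B) \<inter> space M = X -` A \<inter> space M \<inter> (Y -` B \<inter> space M)"
    by auto
  then show "emeasure (distr M S X) A * emeasure (distr M S' Y) B =
      emeasure (distr M (S \<Otimes>\<^sub>M S') (\<lambda>\<omega>. (X \<omega>, Y \<omega>))) (A \<times> B)"
    by (simp add: emeasure_distr emeasure_eq_measure prod ennreal_mult)
qed simp

text \<open>Fubini for independent elements, written with two sample points instead of image
  measures. The first order serves to average over the newest gap with the past fixed, the second to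
  average over the marks with the arrival times fixed.\<close>

lemma (in prob_space) integral_Pair_eq_iterated:
  fixes F :: "'b \<times> 'c \<Rightarrow> complex"
  assumes X[measurable]: "X \<in> measurable M S" and Y[measurable]: "Y \<in> measurable M S'"
    and joint: "distr M S X \<Otimes>\<^sub>M distr M S' Y = distr M (S \<Otimes>\<^sub>M S') (\<lambda>\<omega>. (X \<omega>, Y \<omega>))"
    and F[measurable]: "F \<in> borel_measurable (S \<Otimes>\<^sub>M S')"
    and bound: "\<And>\<omega> \<omega>'. norm (F (X \<omega>, Y \<omega>')) \<le> K"
  shows "(\<integral>\<omega>. F (X \<omega>, Y \<omega>) \<partial>M) = (\<integral>\<omega>. (\<integral>\<omega>'. F (X \<omega>, Y \<omega>') \<partial>M) \<partial>M)"
    and "(\<integral>\<omega>. F (X \<omega>, Y \<omega>) \<partial>M) = (\<integral>\<omega>'. (\<integral>\<omega>. F (X \<omega>, Y \<omega>') \<partial>M) \<partial>M)"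
proof -
  interpret X: prob_space "distr M S X" by (rule prob_space_distr) simp
  interpret Y: prob_space "distr M S' Y" by (rule prob_space_distr) simp
  interpret P: pair_prob_space "distr M S X" "distr M S' Y" ..
  have int: "integrable (distr M S X \<Otimes>\<^sub>M distr M S' Y) F"
    unfolding joint by (subst integrable_distr_eq) (auto intro!: integrable_const_bound[where B=K] bound)
  have inner_Y[measurable]: "(\<lambda>x. \<integral>\<omega>'. F (x, Y \<omega>') \<partial>M) \<in> borel_measurable S"
    by measurable
  have inner_X[measurable]: "(\<lambda>y. \<integral>\<omega>. F (X \<omega>, y) \<partial>M) \<in> borel_measurable S'"
    by measurable
  have 1: "(\<integral>y. F (x, y) \<partial>distr M S' Y) = (\<integral>\<omega>'. F (x, Y \<omega>') \<partial>M)" if "x \<in> space S" for x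
    using that by (intro integral_distr) (auto intro!: measurable_compose[OF measurable_Pair1' F])
  have 2: "(\<integral>x. F (x, y) \<partial>distr M S X) = (\<integral>\<omega>. F (X \<omega>, y) \<partial>M)" if "y \<in> space S'" for y
    using that by (intro integral_distr) (auto intro!: measurable_compose[OF measurable_Pair2' F])
  have whole: "(\<integral>\<omega>. F (X \<omega>, Y \<omega>) \<partial>M) = (\<integral>p. F p \<partial>(distr M S X \<Otimes>\<^sub>M distr M S' Y))"
    unfolding joint by (subst integral_distr) auto
  have "(\<integral>p. F p \<partial>(distr M S X \<Otimes>\<^sub>M distr M S' Y)) = (\<integral>x. (\<integral>y. F (x, y) \<partial>distr M S' Y) \<partial>distr M S X)"
    using int by (rule P.integral_fst'[symmetric])
  also have "\<dots> = (\<integral>x. (\<integral>\<omega>'. F (x, Y \<omega>') \<partial>M) \<partial>distr M S X)"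
    by (intro Bochner_Integration.integral_cong) (auto simp: 1)
  also have "\<dots> = (\<integral>\<omega>. (\<integral>\<omega>'. F (X \<omega>, Y \<omega>') \<partial>M) \<partial>M)"
    by (subst integral_distr) auto
  finally show "(\<integral>\<omega>. F (X \<omega>, Y \<omega>) \<partial>M) = (\<integral>\<omega>. (\<integral>\<omega>'. F (X \<omega>, Y \<omega>') \<partial>M) \<partial>M)"
    using whole by simp
  have "(\<integral>p. F p \<partial>(distr M S X \<Otimes>\<^sub>M distr M S' Y)) = (\<integral>y. (\<integral>x. F (x, y) \<partial>distr M S X) \<partial>distr M S' Y)"
    using P.integral_snd[of "\<lambda>x y. F (x, y)"] int by simp
  also have "\<dots> = (\<integral>y. (\<integral>\<omega>. F (X \<omega>, y) \<partial>M) \<partial>distr M S' Y)"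
    by (intro Bochner_Integration.integral_cong) (auto simp: 2)
  also have "\<dots> = (\<integral>\<omega>'. (\<integral>\<omega>. F (X \<omega>, Y \<omega>') \<partial>M) \<partial>M)"
    by (subst integral_distr) auto
  finally show "(\<integral>\<omega>. F (X \<omega>, Y \<omega>) \<partial>M) = (\<integral>\<omega>'. (\<integral>\<omega>. F (X \<omega>, Y \<omega>') \<partial>M) \<partial>M)"
    using whole by simp
qed

section \<open>Arrival times with independent exponential gaps\<close>

locale exponential_arrivals = prob_space M for M :: "'w measure" +
  fixes \<xi> :: "nat \<Rightarrow> 'w \<Rightarrow> real" and \<alpha> :: real
  assumes indep_\<xi>: "indep_vars (\<lambda>_. borel) \<xi> {1..}"
    and distributed_\<xi>: "1 \<le> i \<Longrightarrow> distributed M lborel (\<xi> i) (exponential_density \<alpha>)"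
    and rate_pos: "0 < \<alpha>"
begin

abbreviation T :: "nat \<Rightarrow> 'w \<Rightarrow> real" where "T \<equiv> arrival_time \<xi>"

lemma measurable_\<xi>: "1 \<le> i \<Longrightarrow> \<xi> i \<in> borel_measurable M"
  using distributed_measurable[OF distributed_\<xi>] by simp

lemma measurable_T[measurable]: "T i \<in> borel_measurable M"
  unfolding arrival_time_def[abs_def] by (intro borel_measurable_sum measurable_\<xi>) auto

lemma T_Suc: "T (Suc m) \<omega> = T m \<omega> + \<xi> (Suc m) \<omega>"
  by (simp add: arrival_time_def)

lemma expectation_\<xi>:
  fixes g :: "real \<Rightarrow> complex"
  assumes [measurable]: "g \<in> borel_measurable borel" and "1 \<le> i"
  shows "(\<integral>\<omega>. g (\<xi> i \<omega>) \<partial>M) = (\<integral>r. exponential_density \<alpha> r *\<^sub>R g r \<partial>lborel)"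
proof -
  have [measurable]: "\<xi> i \<in> borel_measurable M" using measurable_\<xi> assms(2) .
  have "(\<integral>\<omega>. g (\<xi> i \<omega>) \<partial>M) = (\<integral>r. g r \<partial>distr M lborel (\<xi> i))"
    by (subst integral_distr) auto
  also have "\<dots> = (\<integral>r. g r \<partial>density lborel (exponential_density \<alpha>))"
    by (simp add: distributed_distr_eq_density[OF distributed_\<xi>[OF assms(2)]])
  also have "\<dots> = (\<integral>r. exponential_density \<alpha> r *\<^sub>R g r \<partial>lborel)"
    using rate_pos by (subst integral_density) (auto simp: exponential_density_def)
  finally show ?thesis .
qed

end

locale arrivals_and_weight = exponential_arrivals M \<xi> \<alpha> + unit_outside_horizon c B t \<alpha>
  for M :: "'w measure" and \<xi> \<alpha> c B t
begin

lemma norm_prod_le: "norm (\<Prod>i=1..m. c (x i)) \<le> B ^ m"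
  using prod_mono[of "{1..m}" "\<lambda>i. norm (c (x i))" "\<lambda>_. B"] norm_c_le
  by (simp add: prod_norm)

text \<open>A martingale argument: given the first \<open>m\<close> gaps, the next factor
  \<open>c\<close> times the next \<phi> averages to \<open>\<phi> (T m)\<close>, by
  \<open>\<phi>_fixpoint\<close> at \<open>s = T m\<close>. The mean thus keeps its value at
  \<open>m = 0\<close>, where \<open>T 0 = 0\<close>.\<close>

lemma expectation_prod_times_\<phi>:
  "(\<integral>\<omega>. (\<Prod>i=1..m. c (T i \<omega>)) * \<phi> (T m \<omega>) \<partial>M) = \<phi> 0"
proof (induction m)
  case 0
  show ?case by (simp add: arrival_time_def prob_space)
next
  case (Suc m)
  let ?I = "{1..m}" and ?J = "{Suc m}"
  let ?X = "\<lambda>\<omega>. \<lambda>i\<in>?I. \<xi> i \<omega>" and ?Y = "\<lambda>\<omega>. \<lambda>i\<in>?J. \<xi> i \<omega>"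
  let ?S = "\<lambda>I. PiM I (\<lambda>_::nat. borel :: real measure)"
  have indep: "indep_var (?S ?I) ?X (?S ?J) ?Y"
    using indep_var_restrict[OF indep_\<xi>, of ?I ?J] by auto
  \<comment> \<open>Partial sums as functions of the vector of gaps; on the restricted vector they
    agree with \<open>T i\<close> for \<open>i \<le> m\<close>, and \<open>F\<close> uses no
    others.\<close>
  define P where "P x i = (\<Sum>j=1..i. x j)" for x :: "nat \<Rightarrow> real" and i
  define F where "F p = (\<Prod>i=1..m. c (P (fst p) i)) *
    (c (P (fst p) m + snd p (Suc m)) * \<phi> (P (fst p) m + snd p (Suc m)))" for p
  have P_meas: "(\<lambda>p. P (fst p) i) \<in> borel_measurable (?S ?I \<Otimes>\<^sub>M ?S ?J)" if "i \<le> m" for i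
    unfolding P_def using that
    by (intro borel_measurable_sum measurable_compose[OF measurable_fst]) (auto intro!: measurable_component_singleton)
  have [measurable]: "(\<lambda>p. P (fst p) m) \<in> borel_measurable (?S ?I \<Otimes>\<^sub>M ?S ?J)"
    by (rule P_meas) simp
  have [measurable]: "(\<lambda>p. \<Prod>i=1..m. c (P (fst p) i)) \<in> borel_measurable (?S ?I \<Otimes>\<^sub>M ?S ?J)"
    by (intro borel_measurable_prod measurable_compose[OF P_meas measurable_c]) auto
  have [measurable]: "(\<lambda>p. snd p (Suc m)) \<in> borel_measurable (?S ?I \<Otimes>\<^sub>M ?S ?J)"
    by (intro measurable_compose[OF measurable_snd]) (auto intro!: measurable_component_singleton)
  have F: "F \<in> borel_measurable (?S ?I \<Otimes>\<^sub>M ?S ?J)"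
    unfolding F_def[abs_def] by measurable
  have bound: "norm (F p) \<le> B ^ m * (B * exp (\<alpha> * ((B + 1) * t)))" for p
    unfolding F_def norm_mult using norm_prod_le norm_c_le norm_\<phi>_le B_nonneg
    by (intro mult_mono) auto
  have P_X: "P (?X \<omega>) i = T i \<omega>" if "i \<le> m" for i \<omega>
    using that by (auto simp: P_def arrival_time_def intro!: sum.cong)
  have prod_X: "(\<Prod>i=1..m. c (P (?X \<omega>) i)) = (\<Prod>i=1..m. c (T i \<omega>))" for \<omega>
    by (intro prod.cong refl arg_cong[of _ _ c] P_X) auto
  have "(\<integral>\<omega>. (\<Prod>i=1..Suc m. c (T i \<omega>)) * \<phi> (T (Suc m) \<omega>) \<partial>M) = (\<integral>\<omega>. F (?X \<omega>, ?Y \<omega>) \<partial>M)"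
    by (intro Bochner_Integration.integral_cong) (auto simp: F_def P_X prod_X T_Suc mult_ac simp del: One_nat_def)
  also have "\<dots> = (\<integral>\<omega>. (\<integral>\<omega>'. F (?X \<omega>, ?Y \<omega>') \<partial>M) \<partial>M)"
    using indep[unfolded indep_var_distribution_eq]
    by (elim conjE) (rule integral_Pair_eq_iterated(1)[OF _ _ _ F bound])
  also have "\<dots> = (\<integral>\<omega>. (\<Prod>i=1..m. c (T i \<omega>)) * \<phi> (T m \<omega>) \<partial>M)"
  proof (intro Bochner_Integration.integral_cong refl)
    fix \<omega>
    have "(\<integral>\<omega>'. F (?X \<omega>, ?Y \<omega>') \<partial>M) = (\<Prod>i=1..m. c (T i \<omega>)) *
        (\<integral>\<omega>'. c (T m \<omega> + \<xi> (Suc m) \<omega>') * \<phi> (T m \<omega> + \<xi> (Suc m) \<omega>') \<partial>M)"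
      by (simp add: F_def P_X prod_X del: One_nat_def)
    also have "(\<integral>\<omega>'. c (T m \<omega> + \<xi> (Suc m) \<omega>') * \<phi> (T m \<omega> + \<xi> (Suc m) \<omega>') \<partial>M) = \<phi> (T m \<omega>)"
      by (subst expectation_\<xi>) (auto simp: \<phi>_fixpoint)
    finally show "(\<integral>\<omega>'. F (?X \<omega>, ?Y \<omega>') \<partial>M) = (\<Prod>i=1..m. c (T i \<omega>)) * \<phi> (T m \<omega>)" .
  qed
  finally show ?case using Suc by simp
qed

end

section \<open>The characteristic function of shot noise\<close>

context exponential_arrivals
begin

section \<open>Almost sure behaviour of the arrival times\<close>

lemma AE_\<xi>_nonneg: "AE \<omega> in M. \<forall>i\<ge>1. 0 \<le> \<xi> i \<omega>"
proof -
  have "AE \<omega> in M. 1 \<le> i \<longrightarrow> 0 \<le> \<xi> i \<omega>" for i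
  proof (cases "1 \<le> i")
    case True
    show ?thesis
      by (subst distributed_AE2[OF distributed_\<xi>[OF True]]) (auto simp: exponential_density_def True)
  qed auto
  then show ?thesis
    by (simp add: AE_all_countable)
qed

lemma T_mono:
  assumes "\<forall>i\<ge>1. 0 \<le> \<xi> i \<omega>" "i \<le> j"
  shows "T i \<omega> \<le> T j \<omega>"
  unfolding arrival_time_def using assms by (intro sum_mono2) auto

lemma T_nonneg:
  assumes "\<forall>i\<ge>1. 0 \<le> \<xi> i \<omega>"
  shows "0 \<le> T i \<omega>"
  unfolding arrival_time_def using assms by (intro sum_nonneg) auto

text \<open>The weight \<open>2\<close> on \<open>[0, t]\<close> counts arrivals: \<open>E (2 ^ card {i. T i \<le> t}) \<le> exp (\<alpha> t)\<close>.\<close>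

lemma prob_T_le:
  assumes "0 \<le> t"
  shows "prob {\<omega> \<in> space M. \<forall>i\<in>{1..m}. T i \<omega> \<in> {0..t}} \<le> exp (\<alpha> * t) * (1 / 2) ^ m"
proof -
  define E where "E = {\<omega> \<in> space M. \<forall>i\<in>{1..m}. T i \<omega> \<in> {0..t}}"
  have [measurable]: "E \<in> sets M" unfolding E_def by measurable
  define c where "c u = (if u \<in> {0..t} then 2 else 1 :: complex)" for u
  interpret W: arrivals_and_weight M \<xi> \<alpha> c 2 t
    by unfold_locales (auto simp: c_def[abs_def] assms rate_pos)
  \<comment> \<open>For \<open>s \<ge> 0\<close> the weight is 2 on all of \<open>[s,t]\<close>, so
    the integral in the exponent is the time left before the horizon.\<close>
  have \<phi>: "W.\<phi> s = of_real (exp (\<alpha> * max 0 (t - s)))" if "0 \<le> s" for s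
  proof (cases "s \<le> t")
    case True
    have "integral {s..t} (\<lambda>u. c u - 1) = integral {s..t} (\<lambda>u. 1)"
      by (rule integral_cong) (use that in \<open>auto simp: c_def\<close>)
    also have "\<dots> = of_real (t - s)" using True by (simp add: scaleR_conv_of_real)
    finally show ?thesis
      using True unfolding W.\<phi>_def by (simp add: exp_of_real[symmetric])
  qed (simp add: W.\<phi>_beyond)
  define R where "R \<omega> = (\<Prod>i=1..m. if T i \<omega> \<in> {0..t} then 2 else 1 :: real) *
      exp (\<alpha> * max 0 (t - T m \<omega>))" for \<omega>
  have [measurable]: "R \<in> borel_measurable M" unfolding R_def[abs_def] by measurable
  have "AE \<omega> in M. (\<Prod>i=1..m. c (T i \<omega>)) * W.\<phi> (T m \<omega>) = of_real (R \<omega>)"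
    using AE_\<xi>_nonneg
  proof eventually_elim
    case (elim \<omega>)
    have "(\<Prod>i=1..m. c (T i \<omega>)) = of_real (\<Prod>i=1..m. if T i \<omega> \<in> {0..t} then 2 else 1)"
      unfolding of_real_prod c_def by (intro prod.cong) auto
    then show ?case
      unfolding R_def \<phi>[OF T_nonneg[OF elim]] by simp
  qed
  then have "(\<integral>\<omega>. (\<Prod>i=1..m. c (T i \<omega>)) * W.\<phi> (T m \<omega>) \<partial>M) = (\<integral>\<omega>. of_real (R \<omega>) \<partial>M)"
    by (intro integral_cong_AE) measurable
  then have "complex_of_real (\<integral>\<omega>. R \<omega> \<partial>M) = of_real (exp (\<alpha> * t))"
    unfolding W.expectation_prod_times_\<phi> integral_complex_of_real using assms by (simp add: \<phi>)
  then have R_eq: "(\<integral>\<omega>. R \<omega> \<partial>M) = exp (\<alpha> * t)"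
    by (simp only: of_real_eq_iff)
  have R_le: "AE \<omega> in M. norm (R \<omega>) \<le> 2 ^ m * exp (\<alpha> * t)"
    using AE_\<xi>_nonneg
  proof eventually_elim
    case (elim \<omega>)
    have "(\<Prod>i=1..m. if T i \<omega> \<in> {0..t} then 2 else 1 :: real) \<le> 2 ^ m"
      using prod_mono[of "{1..m}" "\<lambda>i. if T i \<omega> \<in> {0..t} then 2 else 1 :: real" "\<lambda>_. 2"] by simp
    moreover have "\<alpha> * max 0 (t - T m \<omega>) \<le> \<alpha> * t"
      using T_nonneg[OF elim] assms rate_pos by (intro mult_left_mono) auto
    ultimately show ?case
      unfolding R_def by (auto simp: abs_mult abs_prod intro!: mult_mono prod_nonneg)
  qed
  \<comment> \<open>On \<open>E\<close> each of the \<open>m\<close> factors is 2 and the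
    exponential is at least 1; elsewhere \<open>R\<close> is nonnegative. Taking means is then
    Markov's inequality.\<close>
  have "2 ^ m * indicator E \<omega> \<le> R \<omega>" for \<omega>
  proof (cases "\<omega> \<in> E")
    case True
    then have "(\<Prod>i=1..m. if T i \<omega> \<in> {0..t} then 2 else 1 :: real) = (\<Prod>i=1..m. 2)"
      by (intro prod.cong) (auto simp: E_def)
    moreover have "1 \<le> exp (\<alpha> * max 0 (t - T m \<omega>))"
      using rate_pos by simp
    ultimately show ?thesis
      using True by (simp add: R_def)
  qed (auto simp: R_def intro!: mult_nonneg_nonneg prod_nonneg)
  then have "(\<integral>\<omega>. 2 ^ m * indicator E \<omega> \<partial>M) \<le> (\<integral>\<omega>. R \<omega> \<partial>M)"
    by (intro integral_mono integrable_const_bound[OF R_le]) (auto intro!: integrable_mult_right integrable_const_bound[where B=1])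
  then have "2 ^ m * prob E \<le> exp (\<alpha> * t)"
    unfolding R_eq by simp
  then show ?thesis
    unfolding E_def[symmetric] by (simp add: field_simps)
qed

text \<open>Borel-Cantelli with the geometric bound: almost surely the events \<open>E m\<close>
  eventually fail. As the gaps are nonnegative, failure means that some \<open>T i\<close> with
  \<open>i \<le> m\<close> lies beyond \<open>t\<close>, and then so does
  \<open>T m\<close>.\<close>

lemma AE_eventually_T_beyond:
  assumes "0 \<le> t"
  shows "AE \<omega> in M. \<forall>\<^sub>F m in sequentially. t < T m \<omega>"
proof -
  define E where "E m = {\<omega> \<in> space M. \<forall>i\<in>{1..m}. T i \<omega> \<in> {0..t}}" for m
  have "AE \<omega> in M. \<forall>\<^sub>F m in sequentially. \<omega> \<in> space M - E m"
  proof (rule borel_cantelli_AE1)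
    show "E m \<in> sets M" for m unfolding E_def by measurable
    show "summable (\<lambda>m. prob (E m))"
    proof (rule summable_comparison_test)
      show "summable (\<lambda>m. exp (\<alpha> * t) * (1 / 2) ^ m :: real)"
        by (intro summable_mult summable_geometric) simp
    qed (use prob_T_le[OF assms] in \<open>auto simp: E_def\<close>)
  qed (simp add: emeasure_eq_measure)
  with AE_\<xi>_nonneg show ?thesis
  proof eventually_elim
    case (elim \<omega>)
    from elim(2) show ?case
    proof eventually_elim
      case (elim m)
      then obtain i where i: "i \<in> {1..m}" "T i \<omega> \<notin> {0..t}" by (auto simp: E_def)
      moreover have "0 \<le> T i \<omega>" "T i \<omega> \<le> T m \<omega>"
        using T_nonneg T_mono \<open>\<forall>i\<ge>1. 0 \<le> \<xi> i \<omega>\<close> i by auto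
      ultimately show ?case by auto
    qed
  qed
qed

end

section \<open>Marks independent of the arrival times\<close>

locale marked_arrivals = exponential_arrivals M \<xi> \<alpha> for M :: "'w measure" and \<xi> \<alpha> +
  fixes N :: "'v measure" and \<Delta> :: "nat \<Rightarrow> 'w \<Rightarrow> 'v" and \<sigma> :: "'v measure"
  assumes indep_\<Delta>: "indep_vars (\<lambda>_. N) \<Delta> {1..}"
    and law_\<Delta>: "1 \<le> i \<Longrightarrow> distr M N (\<Delta> i) = \<sigma>"
    and indep_\<Delta>_T: "indep_elements M
           (PiM {1..} (\<lambda>_. N)) (\<lambda>\<omega>. \<lambda>i\<in>{1..}. \<Delta> i \<omega>)
           (PiM {1..} (\<lambda>_. borel)) (\<lambda>\<omega>. \<lambda>i\<in>{1..}. arrival_time \<xi> i \<omega>)"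
begin

lemma measurable_\<Delta>: "1 \<le> i \<Longrightarrow> \<Delta> i \<in> measurable M N"
  using indep_\<Delta> by (auto simp: indep_vars_def)

lemma sets_\<sigma>[measurable_cong]: "sets \<sigma> = sets N"
  using law_\<Delta>[of 1] by auto

lemma prob_space_\<sigma>: "prob_space \<sigma>"
  using prob_space_distr[OF measurable_\<Delta>[of 1]] law_\<Delta>[of 1] by simp

lemma joint_\<Delta>_T:
  "distr M (PiM {1..} (\<lambda>_. N)) (\<lambda>\<omega>. \<lambda>i\<in>{1..}. \<Delta> i \<omega>) \<Otimes>\<^sub>M
   distr M (PiM {1..} (\<lambda>_. borel)) (\<lambda>\<omega>. \<lambda>i\<in>{1..}. T i \<omega>) =
   distr M (PiM {1..} (\<lambda>_. N) \<Otimes>\<^sub>M PiM {1..} (\<lambda>_. borel))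
     (\<lambda>\<omega>. (\<lambda>i\<in>{1..}. \<Delta> i \<omega>, \<lambda>i\<in>{1..}. T i \<omega>))"
proof (rule distr_Pair_eq_pair_measure)
  fix A B assume "A \<in> sets (PiM {1..} (\<lambda>_::nat. N))" "B \<in> sets (PiM {1..} (\<lambda>_::nat. borel :: real measure))"
  then show "prob ((\<lambda>\<omega>. \<lambda>i\<in>{1..}. \<Delta> i \<omega>) -` A \<inter> space M \<inter> ((\<lambda>\<omega>. \<lambda>i\<in>{1..}. T i \<omega>) -` B \<inter> space M)) =
      prob ((\<lambda>\<omega>. \<lambda>i\<in>{1..}. \<Delta> i \<omega>) -` A \<inter> space M) * prob ((\<lambda>\<omega>. \<lambda>i\<in>{1..}. T i \<omega>) -` B \<inter> space M)"
    using indep_\<Delta>_T unfolding indep_elements_def by (intro indep_setD) auto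
qed (use indep_\<Delta>_T in \<open>auto simp: indep_elements_def\<close>)

lemma measurable_shot_noise:
  assumes [measurable]: "f \<in> borel_measurable (borel \<Otimes>\<^sub>M N)"
  shows "shot_noise T \<Delta> f t \<in> borel_measurable M"
proof -
  have "(\<lambda>\<omega>. shot_noise_term T \<Delta> f t \<omega> i) \<in> borel_measurable M" for i
  proof (cases "1 \<le> i")
    case True
    have [measurable]: "\<Delta> i \<in> measurable M N" using measurable_\<Delta> True .
    show ?thesis unfolding shot_noise_term_def by measurable
  qed (simp add: shot_noise_term_def)
  then show ?thesis
    unfolding shot_noise_def[abs_def] by (rule borel_measurable_suminf)
qed

text \<open>With the arrival times frozen, averaging over the marks replaces each factor
  \<open>g (T i \<omega>, \<Delta> i \<omega>)\<close> by \<open>c (T i \<omega>)\<close>, so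
  \<open>Z m\<close> has mean \<open>\<phi> 0\<close> for \<open>m \<ge> 1\<close>. Almost surely
  \<open>Z m\<close> eventually equals the exponential of the shot noise, and dominated convergence
  gives the limit.\<close>

lemma char_shot_noise:
  assumes f[measurable]: "f \<in> borel_measurable (borel \<Otimes>\<^sub>M N)" and t: "0 \<le> t"
  shows "char (distr M borel (shot_noise T \<Delta> f t)) \<theta> = exp (of_real \<alpha> *
    integral {0..t} (\<lambda>u. (\<integral>x. (if u \<in> {0..t} then iexp (\<theta> * f (u, x)) else 1) \<partial>\<sigma>) - 1))"
proof -
  interpret \<sigma>: prob_space \<sigma> by (rule prob_space_\<sigma>)
  \<comment> \<open>The value 1 outside the horizon matches the zero terms of the truncated
    series.\<close>
  define g where "g p = (if fst p \<in> {0..t} then iexp (\<theta> * f p) else 1)" for p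
  have [measurable]: "g \<in> borel_measurable (borel \<Otimes>\<^sub>M N)" unfolding g_def by measurable
  have norm_g: "norm (g p) \<le> 1" for p by (simp add: g_def)
  define c where "c u = (\<integral>x. g (u, x) \<partial>\<sigma>)" for u
  have norm_c: "norm (c u) \<le> 1" for u
  proof -
    have "norm (c u) \<le> (\<integral>x. norm (g (u, x)) \<partial>\<sigma>)"
      unfolding c_def by (rule integral_norm_bound)
    also have "\<dots> \<le> 1"
      by (intro \<sigma>.integral_le_const \<sigma>.integrable_const_bound[where B=1]) (auto simp: norm_g)
    finally show ?thesis .
  qed
  interpret W: arrivals_and_weight M \<xi> \<alpha> c 1 t
  proof
    show "c \<in> borel_measurable borel" unfolding c_def[abs_def] by measurable
    show "c u = 1" if "u \<notin> {0..t}" for u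
      using that \<sigma>.prob_space by (auto simp: c_def g_def)
  qed (use norm_c t rate_pos in auto)
  define Z where "Z m \<omega> = (\<Prod>i=1..m. g (T i \<omega>, \<Delta> i \<omega>)) * W.\<phi> (T m \<omega>)" for m \<omega>
  have norm_prod_g: "norm (\<Prod>i=1..m. g (x i)) \<le> 1" for x m
    unfolding prod_norm[symmetric] by (intro prod_le_1) (auto simp: norm_g)
  have prod_meas[measurable]: "(\<lambda>\<omega>. \<Prod>i=1..m. g (T i \<omega>, \<Delta> i \<omega>)) \<in> borel_measurable M" for m
    by (intro borel_measurable_prod measurable_compose[OF measurable_Pair[OF measurable_T measurable_\<Delta>]]) auto
  have [measurable]: "Z m \<in> borel_measurable M" for m
    unfolding Z_def[abs_def] by measurable
  let ?SX = "PiM {1..} (\<lambda>_::nat. N)" and ?SY = "PiM {1..} (\<lambda>_::nat. borel :: real measure)"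
  let ?X = "\<lambda>\<omega>. \<lambda>i\<in>{1..}. \<Delta> i \<omega>" and ?Y = "\<lambda>\<omega>. \<lambda>i\<in>{1..}. T i \<omega>"
  have XY: "?X \<in> measurable M ?SX" "?Y \<in> measurable M ?SY"
    using indep_\<Delta>_T by (auto simp: indep_elements_def)
  \<comment> \<open>The sequence of times is indexed from 1 and \<open>F\<close> reads its
    coordinate \<open>m\<close>, hence \<open>1 \<le> m\<close>.\<close>
  have Z_integral: "(\<integral>\<omega>. Z m \<omega> \<partial>M) = W.\<phi> 0" if "1 \<le> m" for m
  proof -
    define F where "F p = (\<Prod>i=1..m. g (snd p i, fst p i)) * W.\<phi> (snd p m)" for p
    have comp[measurable]: "(\<lambda>p. snd p i) \<in> borel_measurable (?SX \<Otimes>\<^sub>M ?SY)"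
      "(\<lambda>p. fst p i) \<in> measurable (?SX \<Otimes>\<^sub>M ?SY) N" if "1 \<le> i" for i
      using that by (auto intro!: measurable_compose[OF measurable_snd] measurable_compose[OF measurable_fst]
          measurable_component_singleton)
    have [measurable]: "(\<lambda>p. W.\<phi> (snd p m)) \<in> borel_measurable (?SX \<Otimes>\<^sub>M ?SY)"
      by (rule measurable_compose[OF comp(1)[OF \<open>1 \<le> m\<close>] W.measurable_\<phi>])
    have [measurable]: "(\<lambda>p. \<Prod>i=1..m. g (snd p i, fst p i)) \<in> borel_measurable (?SX \<Otimes>\<^sub>M ?SY)"
      by (intro borel_measurable_prod measurable_compose[OF measurable_Pair[OF comp]]) auto
    have F: "F \<in> borel_measurable (?SX \<Otimes>\<^sub>M ?SY)"
      unfolding F_def[abs_def] by measurable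
    have bound: "norm (F p) \<le> 1 * exp (\<alpha> * ((1 + 1) * t))" for p
      unfolding F_def norm_mult using norm_prod_g W.norm_\<phi>_le
      by (intro mult_mono) (auto simp del: One_nat_def)
    have F_XY: "F (?X \<omega>, ?Y \<omega>') = (\<Prod>i=1..m. g (T i \<omega>', \<Delta> i \<omega>)) * W.\<phi> (T m \<omega>')" for \<omega> \<omega>'
      using that by (simp add: F_def)
    have "(\<integral>\<omega>. Z m \<omega> \<partial>M) = (\<integral>\<omega>. F (?X \<omega>, ?Y \<omega>) \<partial>M)"
      unfolding F_XY Z_def ..
    also have "\<dots> = (\<integral>\<omega>'. (\<integral>\<omega>. F (?X \<omega>, ?Y \<omega>') \<partial>M) \<partial>M)"
      by (rule integral_Pair_eq_iterated(2)[OF XY joint_\<Delta>_T F bound])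
    also have "\<dots> = (\<integral>\<omega>'. (\<Prod>i=1..m. c (T i \<omega>')) * W.\<phi> (T m \<omega>') \<partial>M)"
    proof (intro Bochner_Integration.integral_cong refl)
      fix \<omega>'
      have g_sec: "(\<lambda>x. g (u, x)) \<in> borel_measurable N" for u by measurable
      have "(\<integral>\<omega>. (\<Prod>i=1..m. g (T i \<omega>', \<Delta> i \<omega>)) \<partial>M) = (\<Prod>i=1..m. \<integral>\<omega>. g (T i \<omega>', \<Delta> i \<omega>) \<partial>M)"
      proof (rule indep_vars_lebesgue_integral)
        have "indep_vars (\<lambda>_. N) \<Delta> {1..m}"
          by (rule indep_vars_subset[OF indep_\<Delta>]) auto
        then show "indep_vars (\<lambda>_. borel) (\<lambda>i \<omega>. g (T i \<omega>', \<Delta> i \<omega>)) {1..m}"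
          by (rule indep_vars_compose2) (rule g_sec)
        show "integrable M (\<lambda>\<omega>. g (T i \<omega>', \<Delta> i \<omega>))" if "i \<in> {1..m}" for i
          by (rule integrable_const_bound[where B=1])
            (use that in \<open>auto simp: norm_g intro!: measurable_compose[OF measurable_\<Delta> g_sec]\<close>)
      qed simp
      also have "\<dots> = (\<Prod>i=1..m. c (T i \<omega>'))"
      proof (rule prod.cong)
        fix i assume "i \<in> {1..m}"
        then have i: "1 \<le> i" by simp
        show "(\<integral>\<omega>. g (T i \<omega>', \<Delta> i \<omega>) \<partial>M) = c (T i \<omega>')"
          unfolding c_def law_\<Delta>[OF i, symmetric]
          by (rule integral_distr[OF measurable_\<Delta>[OF i] g_sec, symmetric])
      qed simp
      finally show "(\<integral>\<omega>. F (?X \<omega>, ?Y \<omega>') \<partial>M) = (\<Prod>i=1..m. c (T i \<omega>')) * W.\<phi> (T m \<omega>')"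
        unfolding F_XY by simp
    qed
    also have "\<dots> = W.\<phi> 0" by (rule W.expectation_prod_times_\<phi>)
    finally show ?thesis .
  qed
  have [measurable]: "shot_noise T \<Delta> f t \<in> borel_measurable M"
    by (rule measurable_shot_noise[OF f])
  have "(\<lambda>m. \<integral>\<omega>. Z m \<omega> \<partial>M) \<longlonglongrightarrow> (\<integral>\<omega>. iexp (\<theta> * shot_noise T \<Delta> f t \<omega>) \<partial>M)"
  proof (rule integral_dominated_convergence)
    show "integrable M (\<lambda>_. exp (\<alpha> * ((1 + 1) * t)))" by simp
    show "AE \<omega> in M. norm (Z m \<omega>) \<le> exp (\<alpha> * ((1 + 1) * t))" for m
    proof (rule AE_I2)
      fix \<omega>
      have "norm (Z m \<omega>) \<le> 1 * exp (\<alpha> * ((1 + 1) * t))"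
        unfolding Z_def norm_mult using norm_prod_g W.norm_\<phi>_le
          by (intro mult_mono) (auto simp del: One_nat_def)
      then show "norm (Z m \<omega>) \<le> exp (\<alpha> * ((1 + 1) * t))" by simp
    qed
    show "AE \<omega> in M. (\<lambda>m. Z m \<omega>) \<longlonglongrightarrow> iexp (\<theta> * shot_noise T \<Delta> f t \<omega>)"
      using AE_eventually_T_beyond[OF t]
    proof eventually_elim
      case (elim \<omega>)
      then obtain m0 where m0: "\<And>m. m0 \<le> m \<Longrightarrow> t < T m \<omega>"
        by (auto simp: eventually_sequentially)
      let ?a = "shot_noise_term T \<Delta> f t \<omega>"
      \<comment> \<open>Index 0 contributes 0 by convention, and an index above \<open>m\<close>
        belongs to an arrival beyond \<open>t\<close>. The series is thus a finite sum and its
        exponential a finite product.\<close>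
      have zero: "?a i = 0" if "i \<notin> {1..m}" "m0 \<le> m" for i m
        using that m0[of i] by (auto simp: shot_noise_term_def)
      have "Z m \<omega> = iexp (\<theta> * shot_noise T \<Delta> f t \<omega>)" if "m0 \<le> m" for m
      proof -
        have "shot_noise T \<Delta> f t \<omega> = (\<Sum>i=1..m. ?a i)"
          unfolding shot_noise_def using zero that by (intro suminf_finite) auto
        then have "iexp (\<theta> * shot_noise T \<Delta> f t \<omega>) = (\<Prod>i=1..m. iexp (\<theta> * ?a i))"
          by (simp add: sum_distrib_left exp_sum)
        also have "\<dots> = (\<Prod>i=1..m. g (T i \<omega>, \<Delta> i \<omega>))"
          by (intro prod.cong) (auto simp: shot_noise_term_def g_def)
        finally show ?thesis
          using m0[OF that] by (simp add: Z_def W.\<phi>_beyond)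
      qed
      then show ?case
        by (intro tendsto_eventually) (auto simp: eventually_sequentially)
    qed
  qed measurable
  moreover have "(\<lambda>m. \<integral>\<omega>. Z m \<omega> \<partial>M) \<longlonglongrightarrow> W.\<phi> 0"
    using Z_integral by (intro tendsto_eventually) (auto simp: eventually_sequentially)
  ultimately have "(\<integral>\<omega>. iexp (\<theta> * shot_noise T \<Delta> f t \<omega>) \<partial>M) = W.\<phi> 0"
    by (rule LIMSEQ_unique)
  then show ?thesis
    by (simp add: char_def integral_distr W.\<phi>_def c_def g_def)
qed

end

section \<open>Compound Poisson laws and total variation\<close>

lemma integral_convolution_bounded:
  fixes f :: "real \<Rightarrow> 'b::{banach, second_countable_topology}"
  assumes "real_distribution \<mu>" "real_distribution \<kappa>"
    and f[measurable]: "f \<in> borel_measurable borel" and bound: "\<And>x. norm (f x) \<le> K"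
  shows "(\<integral>z. f z \<partial>(\<mu> \<star> \<kappa>)) = (\<integral>x. (\<integral>y. f (x + y) \<partial>\<kappa>) \<partial>\<mu>)"
proof -
  interpret \<mu>: real_distribution \<mu> by fact
  interpret \<kappa>: real_distribution \<kappa> by fact
  interpret P: pair_prob_space \<mu> \<kappa> ..
  have [measurable]: "(\<lambda>p. fst p + snd p) \<in> borel_measurable (\<mu> \<Otimes>\<^sub>M \<kappa>)" by measurable
  have int: "integrable (\<mu> \<Otimes>\<^sub>M \<kappa>) (\<lambda>p. f (fst p + snd p))"
    by (rule P.integrable_const_bound[where B=K]) (auto simp: bound)
  have "(\<integral>z. f z \<partial>(\<mu> \<star> \<kappa>)) = (\<integral>p. f (fst p + snd p) \<partial>(\<mu> \<Otimes>\<^sub>M \<kappa>))"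
    unfolding convolution_def by (subst integral_distr) (auto simp: case_prod_beta')
  also have "\<dots> = (\<integral>x. (\<integral>y. f (x + y) \<partial>\<kappa>) \<partial>\<mu>)"
    using P.integral_fst'[OF int] by simp
  finally show ?thesis .
qed

lemma real_distribution_convolution:
  assumes "real_distribution \<mu>" "real_distribution \<kappa>"
  shows "real_distribution (\<mu> \<star> \<kappa>)"
proof -
  interpret \<mu>: real_distribution \<mu> by fact
  interpret \<kappa>: real_distribution \<kappa> by fact
  interpret P: pair_prob_space \<mu> \<kappa> ..
  have "prob_space (\<mu> \<star> \<kappa>)"
    unfolding convolution_def by (rule P.prob_space_distr) measurable
  then show ?thesis
    by (simp add: real_distribution_def real_distribution_axioms_def)
qed

lemma char_convolution:
  assumes "real_distribution \<mu>" "real_distribution \<kappa>"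
  shows "char (\<mu> \<star> \<kappa>) \<theta> = char \<mu> \<theta> * char \<kappa> \<theta>"
proof -
  have "(\<integral>z. iexp (\<theta> * z) \<partial>(\<mu> \<star> \<kappa>)) = (\<integral>x. (\<integral>y. iexp (\<theta> * (x + y)) \<partial>\<kappa>) \<partial>\<mu>)"
    by (rule integral_convolution_bounded[OF assms, where K=1]) auto
  also have "\<dots> = (\<integral>x. (\<integral>y. iexp (\<theta> * x) * iexp (\<theta> * y) \<partial>\<kappa>) \<partial>\<mu>)"
    by (simp add: distrib_left exp_add)
  finally show ?thesis by (simp add: char_def)
qed

text \<open>Conditioning on the summand with law \<kappa> writes both measures as \<kappa>-averages
  over the same translates of \<open>A\<close>; convolving with a common law therefore preserves a
  bound valid on every set.\<close>

lemma measure_convolution_diff_le: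
  assumes \<mu>: "real_distribution \<mu>" and \<mu>': "real_distribution \<mu>'" and \<kappa>: "real_distribution \<kappa>"
    and diff: "\<And>A. A \<in> sets borel \<Longrightarrow> \<bar>measure \<mu> A - measure \<mu>' A\<bar> \<le> \<epsilon>"
    and A[measurable]: "A \<in> sets borel"
  shows "\<bar>measure (\<mu> \<star> \<kappa>) A - measure (\<mu>' \<star> \<kappa>) A\<bar> \<le> \<epsilon>"
proof -
  interpret \<kappa>: real_distribution \<kappa> by fact
  have sections: "{y. x + y \<in> A} \<in> sets borel" for x :: real
    by measurable
  have eq: "measure (\<mu> \<star> \<kappa>) A = (\<integral>x. measure \<mu> {y. x + y \<in> A} \<partial>\<kappa>)"
    and meas: "(\<lambda>x. measure \<mu> {y. x + y \<in> A}) \<in> borel_measurable borel"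
    if \<mu>: "real_distribution \<mu>" for \<mu>
  proof -
    interpret \<mu>: real_distribution \<mu> by fact
    have inner: "(\<integral>y. indicat_real A (x + y) \<partial>\<mu>) = measure \<mu> {y. x + y \<in> A}" for x
    proof -
      have "(\<integral>y. indicat_real A (x + y) \<partial>\<mu>) = (\<integral>y. indicat_real {y. x + y \<in> A} y \<partial>\<mu>)"
        by (simp add: indicator_def)
      then show ?thesis using sections[of x] by simp
    qed
    have "measure (\<mu> \<star> \<kappa>) A = measure (\<kappa> \<star> \<mu>) A"
      by (subst convolution_commutative) (auto intro: \<mu>.finite_measure_axioms \<kappa>.finite_measure_axioms)
    also have "\<dots> = (\<integral>z. indicat_real A z \<partial>(\<kappa> \<star> \<mu>))"
      by simp
    also have "\<dots> = (\<integral>x. (\<integral>y. indicat_real A (x + y) \<partial>\<mu>) \<partial>\<kappa>)"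
      by (rule integral_convolution_bounded[OF \<kappa> \<mu>, where K=1]) auto
    finally show "measure (\<mu> \<star> \<kappa>) A = (\<integral>x. measure \<mu> {y. x + y \<in> A} \<partial>\<kappa>)"
      unfolding inner .
    have "(\<lambda>x. \<integral>y. indicat_real A (x + y) \<partial>\<mu>) \<in> borel_measurable borel"
      by measurable
    then show "(\<lambda>x. measure \<mu> {y. x + y \<in> A}) \<in> borel_measurable borel"
      unfolding inner .
  qed
  have int: "integrable \<kappa> (\<lambda>x. measure \<mu> {y. x + y \<in> A})" if "real_distribution \<mu>" for \<mu>
  proof -
    interpret \<mu>: real_distribution \<mu> by fact
    show ?thesis
      by (rule \<kappa>.integrable_const_bound[where B=1]) (use meas[OF that] in auto)
  qed
  have "\<bar>measure (\<mu> \<star> \<kappa>) A - measure (\<mu>' \<star> \<kappa>) A\<bar>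
      = \<bar>\<integral>x. measure \<mu> {y. x + y \<in> A} - measure \<mu>' {y. x + y \<in> A} \<partial>\<kappa>\<bar>"
    using int \<mu> \<mu>' by (simp add: eq)
  also have "\<dots> \<le> (\<integral>x. \<bar>measure \<mu> {y. x + y \<in> A} - measure \<mu>' {y. x + y \<in> A}\<bar> \<partial>\<kappa>)"
    by (rule integral_abs_bound)
  also have "\<dots> \<le> \<epsilon>"
    using int \<mu> \<mu>' by (intro \<kappa>.integral_le_const) (auto intro!: diff sections)
  finally show ?thesis .
qed

section \<open>Convolution powers\<close>

primrec convolution_power :: "real measure \<Rightarrow> nat \<Rightarrow> real measure" where
  "convolution_power \<nu> 0 = return borel 0"
| "convolution_power \<nu> (Suc k) = (\<nu> \<star> convolution_power \<nu> k)"

lemma real_distribution_convolution_power: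
  assumes "real_distribution \<nu>"
  shows "real_distribution (convolution_power \<nu> k)"
proof (induction k)
  case 0
  show ?case
    by (simp add: real_distribution_def real_distribution_axioms_def prob_space_return)
qed (simp add: real_distribution_convolution assms)

lemma char_convolution_power:
  assumes "real_distribution \<nu>"
  shows "char (convolution_power \<nu> k) \<theta> = char \<nu> \<theta> ^ k"
proof (induction k)
  case 0
  show ?case by (simp add: char_def integral_return)
qed (simp add: char_convolution real_distribution_convolution_power assms)

text \<open>The \<open>k\<close> factors are exchanged one at a time; each exchange costs at most
  \<epsilon>, because the other factors are common to both sides.\<close>

lemma measure_convolution_power_diff_le:
  assumes \<nu>: "real_distribution \<nu>" and \<nu>': "real_distribution \<nu>'"
    and diff: "\<And>A. A \<in> sets borel \<Longrightarrow> \<bar>measure \<nu> A - measure \<nu>' A\<bar> \<le> \<epsilon>"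
    and "A \<in> sets borel"
  shows "\<bar>measure (convolution_power \<nu> k) A - measure (convolution_power \<nu>' k) A\<bar> \<le> k * \<epsilon>"
  using \<open>A \<in> sets borel\<close>
proof (induction k arbitrary: A)
  case (Suc k)
  let ?\<kappa> = "convolution_power \<nu> k" and ?\<kappa>' = "convolution_power \<nu>' k"
  note \<kappa> = real_distribution_convolution_power[OF \<nu>, of k]
    and \<kappa>' = real_distribution_convolution_power[OF \<nu>', of k]
  \<comment> \<open>The comparison of convolutions varies the left factor; commutativity moves the
    changing power there.\<close>
  have comm: "(\<nu>' \<star> \<kappa>) = (\<kappa> \<star> \<nu>')" if "real_distribution \<kappa>" for \<kappa>
    using that \<nu>' by (intro convolution_commutative)
      (auto simp: real_distribution_def real_distribution_axioms_def prob_space_def)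
  have "\<bar>measure (\<nu> \<star> ?\<kappa>) A - measure (\<nu>' \<star> ?\<kappa>) A\<bar> \<le> \<epsilon>"
    by (rule measure_convolution_diff_le[OF \<nu> \<nu>' \<kappa> diff Suc.prems])
  moreover have "\<bar>measure (\<nu>' \<star> ?\<kappa>) A - measure (\<nu>' \<star> ?\<kappa>') A\<bar> \<le> k * \<epsilon>"
    unfolding comm[OF \<kappa>] comm[OF \<kappa>']
    by (rule measure_convolution_diff_le[OF \<kappa> \<kappa>' \<nu>' Suc.IH Suc.prems])
  ultimately show ?case by (simp add: algebra_simps)
qed simp

section \<open>Poisson mixtures of convolution powers\<close>

definition compound_poisson :: "real \<Rightarrow> real measure \<Rightarrow> real measure" where
  "compound_poisson r \<nu> = measure_pmf (poisson_pmf r) \<bind> convolution_power \<nu>"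

lemma measurable_convolution_power:
  assumes "real_distribution \<nu>"
  shows "convolution_power \<nu> \<in> measurable (measure_pmf p) (subprob_algebra borel)"
proof -
  have "convolution_power \<nu> k \<in> space (subprob_algebra borel)" for k
    using real_distribution_convolution_power[OF assms, of k]
    by (simp add: real_distribution_def real_distribution_axioms_def space_subprob_algebra
        prob_space_imp_subprob_space)
  then show ?thesis by simp
qed

lemma real_distribution_compound_poisson:
  assumes "real_distribution \<nu>"
  shows "real_distribution (compound_poisson r \<nu>)"
proof -
  have "prob_space (compound_poisson r \<nu>)"
    unfolding compound_poisson_def
    by (rule measure_pmf.prob_space_bind[OF _ measurable_convolution_power[OF assms]])
      (use real_distribution_convolution_power[OF assms] in \<open>auto simp: real_distribution_def\<close>)
  moreover have "sets (compound_poisson r \<nu>) = sets borel"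
    unfolding compound_poisson_def
    by (rule sets_bind) (use real_distribution_convolution_power[OF assms] in
        \<open>auto simp: real_distribution_def real_distribution_axioms_def\<close>)
  ultimately show ?thesis
    by (simp add: real_distribution_def real_distribution_axioms_def)
qed

text \<open>The probability generating function of the Poisson law at a complex point, read off from
  the exponential series; \<open>norm z \<le> 1\<close> provides integrability.\<close>

lemma integral_poisson_pmf_power:
  fixes z :: complex
  assumes "0 < r" "norm z \<le> 1"
  shows "(\<integral>k. z ^ k \<partial>measure_pmf (poisson_pmf r)) = exp (of_real r * (z - 1))"
proof -
  have sums: "(\<lambda>k. pmf (poisson_pmf r) k *\<^sub>R z ^ k) sums (exp (of_real r * z) * exp (- of_real r))"
  proof -
    have "(\<lambda>k. (of_real r * z) ^ k /\<^sub>R fact k * exp (- of_real r)) sums (exp (of_real r * z) * exp (- of_real r))"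
      by (intro sums_mult2 exp_converges)
    also have "(\<lambda>k. (of_real r * z) ^ k /\<^sub>R fact k * exp (- of_real r)) = (\<lambda>k. pmf (poisson_pmf r) k *\<^sub>R z ^ k)"
      using assms by (auto simp: fun_eq_iff scaleR_conv_of_real power_mult_distrib exp_of_real[symmetric] field_simps)
    finally show ?thesis .
  qed
  have int: "integrable (count_space UNIV) (\<lambda>k. pmf (poisson_pmf r) k *\<^sub>R z ^ k)"
  proof -
    have "integrable (measure_pmf (poisson_pmf r)) (\<lambda>k. z ^ k)"
      using assms(2) by (intro measure_pmf.integrable_const_bound[where B=1])
        (auto simp: norm_power power_le_one)
    then show ?thesis
      by (simp add: measure_pmf_eq_density integrable_density)
  qed
  have "(\<integral>k. z ^ k \<partial>measure_pmf (poisson_pmf r)) = (\<integral>k. pmf (poisson_pmf r) k *\<^sub>R z ^ k \<partial>count_space UNIV)"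
    unfolding measure_pmf_eq_density by (subst integral_density) auto
  also have "\<dots> = exp (of_real r * z) * exp (- of_real r)"
    using sums_unique2[OF sums_integral_count_space_nat[OF int] sums] .
  finally show ?thesis by (simp add: exp_add[symmetric] algebra_simps)
qed

text \<open>Averaging \<open>char \<nu> \<theta> ^ k\<close> over a Poisson count \<open>k\<close>
  is the generating function at \<open>char \<nu> \<theta>\<close>. The mixture is unfolded for the
  real functions cos and sin, and the two parts are put together again.\<close>

lemma char_compound_poisson:
  assumes \<nu>: "real_distribution \<nu>" and "0 < r"
  shows "char (compound_poisson r \<nu>) \<theta> = exp (of_real r * (char \<nu> \<theta> - 1))"
proof -
  let ?p = "measure_pmf (poisson_pmf r)"
  interpret Q: real_distribution "compound_poisson r \<nu>"
    by (rule real_distribution_compound_poisson[OF \<nu>])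
  have rd: "real_distribution (convolution_power \<nu> k)" for k
    by (rule real_distribution_convolution_power[OF \<nu>])
  have bind: "(\<integral>x. h x \<partial>compound_poisson r \<nu>) = (\<integral>k. (\<integral>x. h x \<partial>convolution_power \<nu> k) \<partial>?p)"
    if [measurable]: "h \<in> borel_measurable borel" and "\<And>x. \<bar>h x\<bar> \<le> 1" for h :: "real \<Rightarrow> real"
    unfolding compound_poisson_def
  proof (rule integral_bind[where K=borel and B=1 and B'=1])
    show "AE k in ?p. emeasure (convolution_power \<nu> k) (space (convolution_power \<nu> k)) \<le> ennreal 1"
      using rd by (auto simp: real_distribution_def prob_space.emeasure_space_1)
  qed (use that measurable_convolution_power[OF \<nu>] in \<open>auto intro: measure_pmf.finite_measure_axioms\<close>)
  have Re_Im: "Re (char \<kappa> \<theta>) = (\<integral>x. cos (\<theta> * x) \<partial>\<kappa>)" "Im (char \<kappa> \<theta>) = (\<integral>x. sin (\<theta> * x) \<partial>\<kappa>)"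
    if "real_distribution \<kappa>" for \<kappa>
  proof -
    interpret real_distribution \<kappa> by fact
    have int: "integrable \<kappa> (\<lambda>x. iexp (\<theta> * x))"
      by (rule integrable_const_bound[where B=1]) auto
    show "Re (char \<kappa> \<theta>) = (\<integral>x. cos (\<theta> * x) \<partial>\<kappa>)" "Im (char \<kappa> \<theta>) = (\<integral>x. sin (\<theta> * x) \<partial>\<kappa>)"
      unfolding char_def using integral_Re[OF int] integral_Im[OF int]
      by (simp_all add: Re_exp Im_exp)
  qed
  have norm_char: "norm (char \<nu> \<theta>) \<le> 1"
    using real_distribution.cmod_char_le_1[OF \<nu>] .
  have int: "integrable ?p (\<lambda>k. char (convolution_power \<nu> k) \<theta>)"
    using real_distribution.cmod_char_le_1[OF rd]
    by (intro measure_pmf.integrable_const_bound[where B=1]) auto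
  have "char (compound_poisson r \<nu>) \<theta> = (\<integral>k. char (convolution_power \<nu> k) \<theta> \<partial>?p)"
  proof (rule complex_eqI)
    show "Re (char (compound_poisson r \<nu>) \<theta>) = Re (\<integral>k. char (convolution_power \<nu> k) \<theta> \<partial>?p)"
      using integral_Re[OF int] by (simp add: Re_Im rd Q.real_distribution_axioms bind)
    show "Im (char (compound_poisson r \<nu>) \<theta>) = Im (\<integral>k. char (convolution_power \<nu> k) \<theta> \<partial>?p)"
      using integral_Im[OF int] by (simp add: Re_Im rd Q.real_distribution_axioms bind)
  qed
  then show ?thesis
    by (simp add: char_convolution_power[OF \<nu>] integral_poisson_pmf_power[OF assms(2) norm_char])
qed

lemma abs_min_one_le_one: "0 \<le> x \<Longrightarrow> \<bar>min 1 (x :: real)\<bar> \<le> 1"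
  by (subst abs_of_nonneg) auto

text \<open>Both laws mix over the same count. Given \<open>k\<close> jumps, the difference is at
  most \<open>k * \<epsilon>\<close> by exchanging factors and at most 1 between probabilities; the
  bound is the mean over \<open>k\<close>.\<close>

lemma measure_compound_poisson_diff_le:
  assumes \<nu>: "real_distribution \<nu>" and \<nu>': "real_distribution \<nu>'"
    and diff: "\<And>A. A \<in> sets borel \<Longrightarrow> \<bar>measure \<nu> A - measure \<nu>' A\<bar> \<le> \<epsilon>"
    and A: "A \<in> sets borel"
  shows "\<bar>measure (compound_poisson r \<nu>) A - measure (compound_poisson r \<nu>') A\<bar>
    \<le> (\<integral>k. min 1 (real k * \<epsilon>) \<partial>measure_pmf (poisson_pmf r))"
proof -
  let ?p = "measure_pmf (poisson_pmf r)"
  have eq: "measure (compound_poisson r \<nu>) A = (\<integral>k. measure (convolution_power \<nu> k) A \<partial>?p)"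
    if "real_distribution \<nu>" for \<nu>
    unfolding compound_poisson_def
    by (rule measure_pmf.measure_bind[OF measurable_convolution_power[OF that] A])
  have le1: "measure (convolution_power \<nu> k) A \<le> 1" if "real_distribution \<nu>" for \<nu> k
    using real_distribution_convolution_power[OF that, of k]
    by (auto simp: real_distribution_def prob_space.prob_le_1)
  have int: "integrable ?p (\<lambda>k. measure (convolution_power \<nu> k) A)" if "real_distribution \<nu>" for \<nu>
    by (rule measure_pmf.integrable_const_bound[where B=1]) (auto simp: le1 that)
  have \<epsilon>: "0 \<le> \<epsilon>" using diff[of "{}"] by simp
  have "\<bar>measure (compound_poisson r \<nu>) A - measure (compound_poisson r \<nu>') A\<bar>
      = \<bar>\<integral>k. measure (convolution_power \<nu> k) A - measure (convolution_power \<nu>' k) A \<partial>?p\<bar>"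
    using int \<nu> \<nu>' by (simp add: eq)
  also have "\<dots> \<le> (\<integral>k. \<bar>measure (convolution_power \<nu> k) A - measure (convolution_power \<nu>' k) A\<bar> \<partial>?p)"
    by (rule integral_abs_bound)
  also have "\<dots> \<le> (\<integral>k. min 1 (real k * \<epsilon>) \<partial>?p)"
  proof (rule integral_mono)
    show "integrable ?p (\<lambda>k. min 1 (real k * \<epsilon>))"
      using \<epsilon> by (intro measure_pmf.integrable_const_bound[where B=1]) (auto simp: abs_min_one_le_one)
    show "\<bar>measure (convolution_power \<nu> k) A - measure (convolution_power \<nu>' k) A\<bar> \<le> min 1 (real k * \<epsilon>)" for k
    proof -
      have "\<bar>measure (convolution_power \<nu> k) A - measure (convolution_power \<nu>' k) A\<bar> \<le> 1"
        using le1[OF \<nu>, of k] le1[OF \<nu>', of k]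
          measure_nonneg[of "convolution_power \<nu> k" A] measure_nonneg[of "convolution_power \<nu>' k" A]
        by linarith
      then show ?thesis
        using measure_convolution_power_diff_le[OF \<nu> \<nu>' diff A, of k] by simp
    qed
  qed (use int \<nu> \<nu>' in auto)
  finally show ?thesis .
qed

text \<open>For each fixed \<open>k\<close> the integrand tends to 0, and the cap at 1 supplies the
  dominating function.\<close>

lemma tendsto_integral_min_one:
  fixes \<epsilon> :: "nat \<Rightarrow> real"
  assumes "\<epsilon> \<longlonglongrightarrow> 0" "\<And>n. 0 \<le> \<epsilon> n"
  shows "(\<lambda>n. \<integral>k. min 1 (real k * \<epsilon> n) \<partial>measure_pmf p) \<longlonglongrightarrow> 0"
proof -
  have "(\<lambda>n. \<integral>k. min 1 (real k * \<epsilon> n) \<partial>measure_pmf p) \<longlonglongrightarrow> (\<integral>k. 0 \<partial>measure_pmf p)"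
  proof (rule integral_dominated_convergence[where w="\<lambda>_. 1"])
    show "AE k in measure_pmf p. (\<lambda>n. min 1 (real k * \<epsilon> n)) \<longlonglongrightarrow> 0"
    proof (rule AE_I2)
      fix k
      have "(\<lambda>n. min 1 (real k * \<epsilon> n)) \<longlonglongrightarrow> min 1 (real k * 0)"
        by (intro tendsto_intros assms)
      then show "(\<lambda>n. min 1 (real k * \<epsilon> n)) \<longlonglongrightarrow> 0" by simp
    qed
  qed (use assms(2) in \<open>auto simp: abs_min_one_le_one\<close>)
  then show ?thesis by simp
qed

section \<open>Differences on single sets and the total variation norm\<close>

lemma abs_measure_diff_le_tv_norm:
  assumes N: "finite_measure N" "finite_measure N'" "sets N = sets M" "sets N' = sets M"
    and A: "A \<in> sets M"
  shows "\<bar>measure N A - measure N' A\<bar> \<le> tv_norm M (\<lambda>A. measure N A - measure N' A)"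
proof -
  interpret N: finite_measure N by fact
  interpret N': finite_measure N' by fact
  let ?\<nu> = "\<lambda>A. measure N A - measure N' A"
  obtain P where P: "hahn_positive_set M ?\<nu> P" using hahn_positive_set_exists[OF N] ..
  have [simp]: "P \<in> sets M" "P \<subseteq> space M" "A \<subseteq> space M"
    using P A sets.sets_into_space by (auto simp: hahn_positive_set_def)
  have add: "?\<nu> (B \<union> C) = ?\<nu> B + ?\<nu> C" if "B \<in> sets M" "C \<in> sets M" "B \<inter> C = {}" for B C
    using that N by (simp add: N.finite_measure_Union N'.finite_measure_Union)
  have pos: "0 \<le> ?\<nu> B" if "B \<in> sets M" "B \<subseteq> P" for B
    using P that by (simp add: hahn_positive_set_def)
  have neg: "?\<nu> B \<le> 0" if "B \<in> sets M" "B \<subseteq> space M - P" for B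
    using P that by (simp add: hahn_positive_set_def)
  \<comment> \<open>\<open>A\<close> and the Hahn set \<open>P\<close> cut the space into four
    pieces of known sign; the difference on \<open>A\<close> then lies between those on the
    complement of \<open>P\<close> and on \<open>P\<close>.\<close>
  have "A \<inter> P \<union> (A - P) = A" "A \<inter> P \<union> (P - A) = P"
    "A - P \<union> (space M - P - A) = space M - P"
    using \<open>A \<subseteq> space M\<close> \<open>P \<subseteq> space M\<close> by blast+
  then have "?\<nu> A = ?\<nu> (A \<inter> P) + ?\<nu> (A - P)" "?\<nu> P = ?\<nu> (A \<inter> P) + ?\<nu> (P - A)"
    "?\<nu> (space M - P) = ?\<nu> (A - P) + ?\<nu> (space M - P - A)"
    using A add[of "A \<inter> P" "A - P"] add[of "A \<inter> P" "P - A"] add[of "A - P" "space M - P - A"]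
    by (auto simp only: sets.Int sets.Diff sets.top \<open>P \<in> sets M\<close>)
  moreover have "0 \<le> ?\<nu> (A \<inter> P)" "0 \<le> ?\<nu> (P - A)" using A by (intro pos; auto)+
  moreover have "?\<nu> (A - P) \<le> 0" "?\<nu> (space M - P - A) \<le> 0"
    using A \<open>A \<subseteq> space M\<close> by (intro neg; blast intro: sets.Diff sets.top \<open>P \<in> sets M\<close>)+
  ultimately show ?thesis
    unfolding tv_norm_eq[OF N P] by linarith
qed

text \<open>The norm is the difference on a Hahn set minus that on its complement, and each is at
  most \<epsilon> in absolute value.\<close>

lemma tv_norm_le_twice:
  assumes N: "finite_measure N" "finite_measure N'" "sets N = sets M" "sets N' = sets M"
    and le: "\<And>A. A \<in> sets M \<Longrightarrow> \<bar>measure N A - measure N' A\<bar> \<le> \<epsilon>"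
  shows "tv_norm M (\<lambda>A. measure N A - measure N' A) \<le> 2 * \<epsilon>"
proof -
  obtain P where P: "hahn_positive_set M (\<lambda>A. measure N A - measure N' A) P"
    using hahn_positive_set_exists[OF N] ..
  then have "P \<in> sets M" by (simp add: hahn_positive_set_def)
  then show ?thesis
    unfolding tv_norm_eq[OF N P] using le[of P] le[of "space M - P"] by auto
qed

section \<open>Convergence of shot noise\<close>

text \<open>For \<open>t > 0\<close> and a probability measure \<sigma> the image has mass
  \<open>t\<close>, so this is the law of \<open>f (U, X)\<close> with \<open>U\<close> uniform on
  \<open>[0,t]\<close> and \<open>X\<close> an independent element with law \<sigma>.\<close>

definition normalized_image :: "real \<Rightarrow> 'v measure \<Rightarrow> (real \<times> 'v \<Rightarrow> real) \<Rightarrow> real measure" where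
  "normalized_image t \<sigma> f =
     density (distr (restrict_space lborel {0..t} \<Otimes>\<^sub>M \<sigma>) borel f) (\<lambda>_. ennreal (1 / t))"

context marked_arrivals
begin

section \<open>The image measure and the jump law\<close>

lemma measurable_restrict_pair:
  fixes t :: real
  assumes [measurable]: "f \<in> borel_measurable (borel \<Otimes>\<^sub>M N)"
  shows "f \<in> borel_measurable (restrict_space lborel {0..t} \<Otimes>\<^sub>M \<sigma>)"
proof -
  have [measurable]: "(\<lambda>u. u) \<in> measurable (restrict_space lborel {0..t}) borel"
    by (rule measurable_restrict_space1) simp
  have "(\<lambda>p. f (fst p, snd p)) \<in> borel_measurable (restrict_space lborel {0..t} \<Otimes>\<^sub>M \<sigma>)"
    by measurable
  then show ?thesis by simp
qed

lemma emeasure_restrict_pair_space: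
  assumes "0 \<le> t"
  shows "emeasure (restrict_space lborel {0..t} \<Otimes>\<^sub>M \<sigma>) (space (restrict_space lborel {0..t} \<Otimes>\<^sub>M \<sigma>)) = ennreal t"
proof -
  interpret \<sigma>: prob_space \<sigma> by (rule prob_space_\<sigma>)
  have "{0..t} \<in> sets (restrict_space lborel {0..t})"
    by (simp add: sets_restrict_space_iff)
  then show ?thesis
    using assms by (simp add: space_pair_measure \<sigma>.emeasure_pair_measure_Times \<sigma>.emeasure_space_1
        emeasure_restrict_space space_restrict_space)
qed

lemma finite_measure_image:
  fixes t :: real
  assumes "f \<in> borel_measurable (borel \<Otimes>\<^sub>M N)" "0 \<le> t"
  shows "finite_measure (distr (restrict_space lborel {0..t} \<Otimes>\<^sub>M \<sigma>) borel f)"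
  using measurable_restrict_pair[OF assms(1)] emeasure_restrict_pair_space[OF assms(2)]
  by (intro finite_measure.finite_measure_distr finite_measureI) auto

lemma measure_normalized_image:
  assumes "f \<in> borel_measurable (borel \<Otimes>\<^sub>M N)" "0 < t" "A \<in> sets borel"
  shows "measure (normalized_image t \<sigma> f) A =
    measure (distr (restrict_space lborel {0..t} \<Otimes>\<^sub>M \<sigma>) borel f) A / t"
  unfolding normalized_image_def measure_def using assms
  by (subst emeasure_density_const) (auto simp: enn2real_mult)

lemma real_distribution_normalized_image:
  assumes f: "f \<in> borel_measurable (borel \<Otimes>\<^sub>M N)" and t: "0 < t"
  shows "real_distribution (normalized_image t \<sigma> f)"
proof -
  have "emeasure (distr (restrict_space lborel {0..t} \<Otimes>\<^sub>M \<sigma>) borel f) UNIV = ennreal t"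
    using measurable_restrict_pair[OF f] emeasure_restrict_pair_space[of t] t
    by (subst emeasure_distr) auto
  then have "emeasure (normalized_image t \<sigma> f) UNIV = 1"
    using t by (simp add: normalized_image_def emeasure_density_const ennreal_mult[symmetric])
  then show ?thesis
    by (intro real_distribution.intro prob_spaceI real_distribution_axioms.intro)
      (simp_all add: normalized_image_def)
qed

text \<open>Both characteristic functions are exponentials. Fubini identifies the exponents: the
  integral of \<open>c\<close> over \<open>[0,t]\<close> is \<open>t\<close> times the
  characteristic function of the jump law. Levy uniqueness concludes.\<close>

lemma law_shot_noise:
  assumes f[measurable]: "f \<in> borel_measurable (borel \<Otimes>\<^sub>M N)" and t: "0 < t"
  shows "distr M borel (shot_noise T \<Delta> f t) = compound_poisson (\<alpha> * t) (normalized_image t \<sigma> f)"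
proof (rule Levy_uniqueness)
  let ?L = "restrict_space lborel {0..t}" and ?\<nu> = "normalized_image t \<sigma> f"
  note \<nu> = real_distribution_normalized_image[OF f t]
  show "real_distribution (distr M borel (shot_noise T \<Delta> f t))"
    using measurable_shot_noise[OF f] by (rule real_distribution_distr)
  show "real_distribution (compound_poisson (\<alpha> * t) ?\<nu>)"
    by (rule real_distribution_compound_poisson[OF \<nu>])
  show "char (distr M borel (shot_noise T \<Delta> f t)) = char (compound_poisson (\<alpha> * t) ?\<nu>)"
  proof
    fix \<theta>
    interpret \<sigma>: prob_space \<sigma> by (rule prob_space_\<sigma>)
    interpret L: finite_measure ?L
      by (rule finite_measureI) (simp add: space_restrict_space emeasure_restrict_space emeasure_lborel_Icc_eq)
    interpret P: pair_sigma_finite ?L \<sigma> ..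
    interpret L\<sigma>: finite_measure "?L \<Otimes>\<^sub>M \<sigma>"
      by (rule finite_measureI) (use emeasure_restrict_pair_space[of t] t in auto)
    note fL[measurable] = measurable_restrict_pair[OF f, of t]
    define c where "c u = (\<integral>x. (if u \<in> {0..t} then iexp (\<theta> * f (u, x)) else 1) \<partial>\<sigma>)" for u
    have c_meas: "c \<in> borel_measurable borel"
      unfolding c_def[abs_def] by measurable
    have norm_c: "norm (c u) \<le> 1" for u
    proof -
      have "norm (c u) \<le> (\<integral>x. norm (if u \<in> {0..t} then iexp (\<theta> * f (u, x)) else 1) \<partial>\<sigma>)"
        unfolding c_def by (rule integral_norm_bound)
      also have "\<dots> \<le> 1"
        by (intro \<sigma>.integral_le_const \<sigma>.integrable_const_bound[where B=1]) auto
      finally show ?thesis .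
    qed
    have int: "integrable (?L \<Otimes>\<^sub>M \<sigma>) (\<lambda>p. iexp (\<theta> * f p))"
      by (rule L\<sigma>.integrable_const_bound[where B=1]) auto
    have "integral {0..t} c = (\<integral>u. indicator {0..t} u *\<^sub>R c u \<partial>lborel)"
      by (rule integral_lborel_indicator_bounded(2)[OF c_meas norm_c])
    also have "\<dots> = (\<integral>u. c u \<partial>?L)"
      by (simp add: integral_restrict_space)
    also have "\<dots> = (\<integral>u. (\<integral>x. iexp (\<theta> * f (u, x)) \<partial>\<sigma>) \<partial>?L)"
      by (intro Bochner_Integration.integral_cong) (auto simp: c_def space_restrict_space)
    also have "\<dots> = (\<integral>p. iexp (\<theta> * f p) \<partial>(?L \<Otimes>\<^sub>M \<sigma>))"
      by (rule P.integral_fst'[OF int])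
    also have "\<dots> = (\<integral>x. iexp (\<theta> * x) \<partial>distr (?L \<Otimes>\<^sub>M \<sigma>) borel f)"
      by (subst integral_distr) auto
    also have "\<dots> = of_real t * char ?\<nu> \<theta>"
      unfolding char_def normalized_image_def using t
      by (subst integral_density) (auto simp: scaleR_conv_of_real)
    finally have c_eq: "integral {0..t} c = of_real t * char ?\<nu> \<theta>" .
    have "integral {0..t} (\<lambda>u. c u - 1) = of_real t * (char ?\<nu> \<theta> - 1)"
      using t integral_lborel_indicator_bounded(1)[OF c_meas norm_c]
      by (subst Henstock_Kurzweil_Integration.integral_diff)
        (auto simp: c_eq scaleR_conv_of_real algebra_simps)
    then show "char (distr M borel (shot_noise T \<Delta> f t)) \<theta> = char (compound_poisson (\<alpha> * t) ?\<nu>) \<theta>"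
      unfolding char_shot_noise[OF f less_imp_le[OF t]] c_def[symmetric]
      using rate_pos t by (simp add: char_compound_poisson[OF \<nu>] mult_ac)
  qed
qed

text \<open>For \<open>n \<ge> 1\<close> the laws are compound Poisson with the common rate
  \<open>\<alpha> * t\<close>, so only the jump laws vary. The variation distance of the images,
  divided by \<open>t\<close>, bounds the difference of jump laws on every set; mixing over the
  count gives \<open>b n\<close>, and \<open>2 * b n\<close> bounds the variation distance of the
  shot noises.\<close>

lemma converges_in_variation_shot_noise:
  assumes fn: "\<And>n. 1 \<le> n \<Longrightarrow> fn n \<in> borel_measurable (borel \<Otimes>\<^sub>M N)"
    and f: "f \<in> borel_measurable (borel \<Otimes>\<^sub>M N)" and t: "0 < t"
    and conv: "converges_in_variation
           (\<lambda>n. distr (restrict_space lborel {0..t} \<Otimes>\<^sub>M \<sigma>) borel (fn n))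
           (distr (restrict_space lborel {0..t} \<Otimes>\<^sub>M \<sigma>) borel f)"
  shows "converges_in_variation (\<lambda>n. distr M borel (shot_noise T \<Delta> (fn n) t))
           (distr M borel (shot_noise T \<Delta> f t))"
proof -
  let ?\<rho> = "\<lambda>f. distr (restrict_space lborel {0..t} \<Otimes>\<^sub>M \<sigma>) borel f"
  let ?law = "\<lambda>f. distr M borel (shot_noise T \<Delta> f t)"
  define tv where "tv n = tv_norm borel (\<lambda>A. measure (?\<rho> (fn n)) A - measure (?\<rho> f) A)" for n
  \<comment> \<open>The absolute value keeps the argument nonnegative at \<open>n = 0\<close> as
    well, where nothing is known about \<open>fn 0\<close>.\<close>
  define b where "b n = (\<integral>k. min 1 (real k * (\<bar>tv n\<bar> / t)) \<partial>measure_pmf (poisson_pmf (\<alpha> * t)))" for n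
  note finite_image = finite_measure_image[OF _ less_imp_le[OF t]]
  have finite_law: "finite_measure (?law f)" if "f \<in> borel_measurable (borel \<Otimes>\<^sub>M N)" for f
    by (intro finite_measure_distr measurable_shot_noise that)
  have law_diff: "\<bar>measure (?law (fn n)) A - measure (?law f) A\<bar> \<le> b n" if "1 \<le> n" "A \<in> sets borel" for n A
    unfolding law_shot_noise[OF fn[OF that(1)] t] law_shot_noise[OF f t] b_def
  proof (rule measure_compound_poisson_diff_le)
    fix A :: "real set" assume A: "A \<in> sets borel"
    have "\<bar>measure (?\<rho> (fn n)) A - measure (?\<rho> f) A\<bar> \<le> tv n"
      unfolding tv_def using A that by (intro abs_measure_diff_le_tv_norm finite_image fn f) auto
    then show "\<bar>measure (normalized_image t \<sigma> (fn n)) A - measure (normalized_image t \<sigma> f) A\<bar> \<le> \<bar>tv n\<bar> / t"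
      using t by (simp add: measure_normalized_image[OF fn[OF that(1)] t A] measure_normalized_image[OF f t A]
          diff_divide_distrib[symmetric] divide_right_mono)
  qed (rule real_distribution_normalized_image[OF fn[OF that(1)] t]
      real_distribution_normalized_image[OF f t] that(2))+
  have "tv \<longlonglongrightarrow> 0"
    using conv unfolding converges_in_variation_def tv_def .
  then have "(\<lambda>n. \<bar>tv n\<bar> / t) \<longlonglongrightarrow> 0"
    by (auto intro!: tendsto_divide_zero tendsto_rabs_zero)
  then have "b \<longlonglongrightarrow> 0"
    unfolding b_def[abs_def] using t by (intro tendsto_integral_min_one) auto
  then have b: "(\<lambda>n. 2 * b n) \<longlonglongrightarrow> 0"
    by (rule tendsto_mult_right_zero)
  have "\<forall>\<^sub>F n in sequentially.
      norm (tv_norm borel (\<lambda>A. measure (?law (fn n)) A - measure (?law f) A)) \<le> 2 * b n"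
    using eventually_ge_at_top[of 1]
  proof eventually_elim
    case (elim n)
    note finite = finite_law[OF fn[OF elim]] finite_law[OF f]
    have "0 \<le> tv_norm borel (\<lambda>A. measure (?law (fn n)) A - measure (?law f) A)"
      using abs_measure_diff_le_tv_norm[OF finite, of borel "{}"] by simp
    moreover have "tv_norm borel (\<lambda>A. measure (?law (fn n)) A - measure (?law f) A) \<le> 2 * b n"
      by (rule tv_norm_le_twice[OF finite]) (auto intro: law_diff[OF elim])
    ultimately show ?case by simp
  qed
  then show ?thesis
    unfolding converges_in_variation_def by (rule Lim_null_comparison[OF _ b])
qed

end

theorem proposition3p2:
  fixes M :: "'w measure"
    and \<sigma> :: "(real ^ 'd) measure"
    and \<Delta> :: "nat \<Rightarrow> 'w \<Rightarrow> real ^ 'd"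
    and \<xi> T :: "nat \<Rightarrow> 'w \<Rightarrow> real"
    and \<alpha> t :: real
    and fn :: "nat \<Rightarrow> real \<times> (real ^ 'd) \<Rightarrow> real"
    and f :: "real \<times> (real ^ 'd) \<Rightarrow> real"
  assumes "prob_space M"
    and "prob_space.indep_vars M (\<lambda>_. borel) \<Delta> {1..}"
    and "\<And>i. i \<ge> 1 \<Longrightarrow> distr M borel (\<Delta> i) = \<sigma>"
    and "emeasure \<sigma> {0} = 0"
    and "\<alpha> > 0"
    and "prob_space.indep_vars M (\<lambda>_. borel) \<xi> {1..}"
    and "\<And>i. i \<ge> 1 \<Longrightarrow> distributed M lborel (\<xi> i) (exponential_density \<alpha>)"
    and "T = arrival_time \<xi>"
    and "indep_elements M
           (PiM {1..} (\<lambda>_. borel)) (\<lambda>\<omega>. \<lambda>i\<in>{1..}. \<Delta> i \<omega>)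
           (PiM {1..} (\<lambda>_. borel)) (\<lambda>\<omega>. \<lambda>i\<in>{1..}. T i \<omega>)"
    and "t > 0"
    and "\<And>n. n \<ge> 1 \<Longrightarrow> fn n \<in> borel_measurable (restrict_space borel {0..} \<Otimes>\<^sub>M borel)"
    and "f \<in> borel_measurable (restrict_space borel {0..} \<Otimes>\<^sub>M borel)"
    and "\<And>n. n \<ge> 1 \<Longrightarrow> shot_noise_well_defined M T \<Delta> (fn n) t"
    and "shot_noise_well_defined M T \<Delta> f t"
    and "converges_in_variation
           (\<lambda>n. distr (restrict_space lborel {0..t} \<Otimes>\<^sub>M \<sigma>) borel (fn n))
           (distr (restrict_space lborel {0..t} \<Otimes>\<^sub>M \<sigma>) borel f)"
  shows "converges_in_variation
           (\<lambda>n. distr M borel (shot_noise T \<Delta> (fn n) t))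
           (distr M borel (shot_noise T \<Delta> f t))"
proof -
  interpret prob_space M by fact
  interpret marked_arrivals M \<xi> \<alpha> borel \<Delta> \<sigma>
    using assms by unfold_locales auto
  \<comment> \<open>Nothing is assumed about \<open>f\<close> at negative times, where it may fail to be measurable.\<close>
  define nonneg :: "real \<times> (real ^ 'd) \<Rightarrow> real \<times> (real ^ 'd)" where "nonneg p = (max 0 (fst p), snd p)" for p
  have "(\<lambda>p. max 0 (fst p)) \<in> measurable (borel \<Otimes>\<^sub>M borel) (restrict_space borel {0::real..})"
    by (rule measurable_restrict_space2) auto
  then have nonneg: "nonneg \<in> measurable (borel \<Otimes>\<^sub>M borel) (restrict_space borel {0..} \<Otimes>\<^sub>M borel)"
    unfolding nonneg_def[abs_def] by measurable
  \<comment> \<open>On \<open>[0,t]\<close> the map \<open>nonneg\<close> changes nothing, and both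
    the series and the image measure evaluate \<open>g\<close> at such times only.\<close>
  have sn: "shot_noise (arrival_time \<xi>) \<Delta> (g \<circ> nonneg) t = shot_noise (arrival_time \<xi>) \<Delta> g t" for g
    unfolding shot_noise_def shot_noise_term_def nonneg_def by (auto simp: fun_eq_iff intro!: suminf_cong)
  have image: "distr (restrict_space lborel {0..t} \<Otimes>\<^sub>M \<sigma>) borel (g \<circ> nonneg) =
      distr (restrict_space lborel {0..t} \<Otimes>\<^sub>M \<sigma>) borel g" for g
    by (intro distr_cong) (auto simp: nonneg_def space_pair_measure space_restrict_space)
  show ?thesis
    using converges_in_variation_shot_noise[of "\<lambda>n. fn n \<circ> nonneg" "f \<circ> nonneg" t] assms nonneg
    by (simp add: sn image)
qed

end
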